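(* Let $A$ be a $\Delta^0_2$ set and let $C_0,C_1,\ldots$ be uniformly $\Delta^0_2$ sets, each noncomputable (i.e., $C_i>_T 0$ for all $i$). Then either $A$ or $\overline{A}$ has an infinite $\Delta^0_2$ subset $X$ such that $C_i\not\leq_T X$ for all $i$.
   Context: Sets $C_0,C_1,\ldots$ are uniformly $\Delta^0_2$ if there is a single $0'$-computable procedure computing $C_i(n)$ from $i,n$. *)

theory Defs
  imports Main "HOL-Library.Nat_Bijection"
begin

datatype recf =
    Z
  | S
  | Proj nat
  | Orc
  | Comp recf "recf list"
  | Prim recf recf
  | Mn recf

definition arg :: "nat list \<Rightarrow> nat \<Rightarrow> nat" where
  "arg xs i = (if i < length xs then xs ! i else 0)"

inductive evalo :: "nat set \<Rightarrow> recf \<Rightarrow> nat list \<Rightarrow> nat \<Rightarrow> bool" for Ora :: "nat set" where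
  ev_Z: "evalo Ora Z xs 0"
| ev_S: "evalo Ora S xs (Suc (arg xs 0))"
| ev_Proj: "evalo Ora (Proj i) xs (arg xs i)"
| ev_Orc: "evalo Ora Orc xs (if arg xs 0 \<in> Ora then 1 else 0)"
| ev_Comp: "list_all2 (\<lambda>g y. evalo Ora g xs y) gs ys \<Longrightarrow> evalo Ora f ys v \<Longrightarrow> evalo Ora (Comp f gs) xs v"
| ev_Prim0: "evalo Ora f xs v \<Longrightarrow> evalo Ora (Prim f g) (0 # xs) v"
| ev_PrimS: "evalo Ora (Prim f g) (n # xs) r \<Longrightarrow> evalo Ora g (n # r # xs) v \<Longrightarrow> evalo Ora (Prim f g) (Suc n # xs) v"
| ev_Mn: "evalo Ora f (n # xs) 0 \<Longrightarrow> (\<forall>m<n. \<exists>w. w \<noteq> 0 \<and> evalo Ora f (m # xs) w) \<Longrightarrow> evalo Ora (Mn f) xs n"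
monos list_all2_mono

primrec encode :: "recf \<Rightarrow> nat" where
  "encode Z = prod_encode (0, 0)"
| "encode S = prod_encode (1, 0)"
| "encode (Proj i) = prod_encode (2, i)"
| "encode Orc = prod_encode (3, 0)"
| "encode (Comp f gs) = prod_encode (4, prod_encode (encode f, list_encode (map encode gs)))"
| "encode (Prim f g) = prod_encode (5, prod_encode (encode f, encode g))"
| "encode (Mn f) = prod_encode (6, encode f)"

definition chi :: "nat set \<Rightarrow> nat \<Rightarrow> nat" where
  "chi A n = (if n \<in> A then 1 else 0)"

definition turing_reducible :: "nat set \<Rightarrow> nat set \<Rightarrow> bool" (infix "\<le>\<^sub>T" 50) where
  "A \<le>\<^sub>T B \<longleftrightarrow> (\<exists>f. \<forall>n. evalo B f [n] (chi A n))"

definition computable_set :: "nat set \<Rightarrow> bool" where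
  "computable_set A \<longleftrightarrow> A \<le>\<^sub>T {}"

definition halting_set :: "nat set" where
  "halting_set = {encode f | f. \<exists>v. evalo {} f [encode f] v}"

definition Delta02 :: "nat set \<Rightarrow> bool" where
  "Delta02 A \<longleftrightarrow> A \<le>\<^sub>T halting_set"

definition uniformly_Delta02 :: "(nat \<Rightarrow> nat set) \<Rightarrow> bool" where
  "uniformly_Delta02 C \<longleftrightarrow> (\<exists>f. \<forall>i n. evalo halting_set f [i, n] (chi (C i) n))"

end

(*
Two strings extending s, with new elements in Y, form a splitting for program e if they compute
different values at some input. If a set X extends s inside a set L without splittings, then every
C i computable from X by e is computable from L; if a splitting is available inside A (or inside
the complement of A), one of its two strings computes a value different from C i.

One application of a low basis theorem with cone avoidance gives a set G with jump computable from
0' that computes no C i, and whose columns L p contain UNIV and are closed under choosing, from a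
nonempty class of partitions of L p with prescribed absence of splittings in both halves, the first
half of a member.

If for some infinite L p every splitting question over L p is settled by a splitting inside A or by
the absence of splittings beyond some bound, finite extensions give a subset of A. Otherwise every
infinite L p has a pair (s, e) with splittings arbitrarily far out in L p, but none inside A. For such a
pair, consider partitions L p = Y + (L p - Y) where Y has no splitting for the next requirement and
L p - Y has no splitting for (s, e). If there is none, then L p - A has a splitting for the requirement,
which diagonalizes; if there is one, the chosen Y is infinite and becomes the new reservoir. The
pair (s, e) is guessed; wrong guesses are refuted by 0', and a finite injury argument
builds a subset of the complement of A.
*)
theory Submission
  imports Defs "HOL-Library.Sublist" "HOL-Library.Infinite_Set"
begin

subsection \<open>Relative computability of functions on coded types\<close>

text \<open>Every decision of the constructions must be made by \<open>halting_set\<close>.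
  Questions about splittings inside \<open>L p\<close> are existential relative to \<open>G\<close>,
  so lowness of \<open>G\<close> makes them decidable; cone avoidance of \<open>G\<close> turns the
  absence of splittings into a contradiction. Choosing reservoirs by repeated basis theorems would
  mean carrying lowness indices along, so all possible choices are columns of one set. Nonemptiness
  of a class of partitions is not decidable, so the tree for \<open>G\<close> only demands, length
  by length, that a column be admissible whenever some string is.

  The set \<open>A\<close> is merely computable from 0', so the absence of splittings inside
  \<open>A\<close> can be refuted by 0' but not confirmed; this is the source of guesses and
  injuries. The partition into \<open>L p - A\<close> and \<open>L p \<inter> A\<close> is never
  searched for: it only witnesses that a class is nonempty, or else yields a splitting inside
  \<open>L p - A\<close>. Guesses ask for splittings arbitrarily far out so that the chosen half
  cannot be finite.\<close>

lemma list_all2_evalo_det: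
  assumes "list_all2 (\<lambda>g y. evalo Ora g xs y \<and> (\<forall>w. evalo Ora g xs w \<longrightarrow> y = w)) gs ys"
    and "list_all2 (\<lambda>g y. evalo Ora g xs y) gs zs"
  shows "ys = zs"
  using assms
proof (induction gs arbitrary: ys zs)
  case (Cons g gs)
  then show ?case by (auto simp: list_all2_Cons1)
qed auto

lemma evalo_det: "evalo Ora f xs v \<Longrightarrow> evalo Ora f xs w \<Longrightarrow> v = w"
proof (induction arbitrary: w rule: evalo.induct)
  case (ev_Z xs)
  from ev_Z.prems show ?case by (cases rule: evalo.cases) auto
next
  case (ev_S xs)
  from ev_S.prems show ?case by (cases rule: evalo.cases) auto
next
  case (ev_Proj i xs)
  from ev_Proj.prems show ?case by (cases rule: evalo.cases) auto
next
  case (ev_Orc xs)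
  from ev_Orc.prems show ?case by (cases rule: evalo.cases) auto
next
  case (ev_Comp xs gs ys f v)
  from ev_Comp.prems obtain zs where z: "list_all2 (\<lambda>g y. evalo Ora g xs y) gs zs"
    and fz: "evalo Ora f zs w" by (cases rule: evalo.cases) auto
  have "ys = zs" by (rule list_all2_evalo_det[OF _ z]) (use ev_Comp(1) in blast)
  with fz ev_Comp.IH show ?case by auto
next
  case (ev_Prim0 f xs v g)
  from ev_Prim0.prems show ?case by (cases rule: evalo.cases) (auto dest: ev_Prim0.IH)
next
  case (ev_PrimS f g n xs r v)
  from ev_PrimS.prems show ?case by (cases rule: evalo.cases) (auto dest: ev_PrimS.IH)
next
  case (ev_Mn f n xs)
  from ev_Mn.prems obtain a: "evalo Ora f (w # xs) 0"
    and b: "\<forall>m<w. \<exists>z. z \<noteq> 0 \<and> evalo Ora f (m # xs) z" by (cases rule: evalo.cases) auto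
  show ?case
  proof (rule ccontr)
    assume "n \<noteq> w"
    then consider "n < w" | "w < n" by linarith
    then show False
    proof cases
      case 1
      with b obtain z where "z \<noteq> 0" "evalo Ora f (n # xs) z" by auto
      with ev_Mn.IH(1) show False by auto
    next
      case 2
      with ev_Mn.IH(2) obtain z where "z \<noteq> 0" "\<forall>y. evalo Ora f (w # xs) y \<longrightarrow> z = y" by auto
      with a show False by auto
    qed
  qed
qed

section \<open>Programs for arithmetic and Cantor pairing\<close>

inductive_cases evalo_CompE: "evalo Ora (Comp f gs) xs v"

lemma evalo_Comp1: "evalo Ora g xs y \<Longrightarrow> evalo Ora f [y] v \<Longrightarrow> evalo Ora (Comp f [g]) xs v"
  by (rule ev_Comp[where ys = "[y]"]) auto

lemma evalo_Comp2:
  "evalo Ora g xs y \<Longrightarrow> evalo Ora h xs z \<Longrightarrow> evalo Ora f [y, z] v \<Longrightarrow> evalo Ora (Comp f [g, h]) xs v"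
  by (rule ev_Comp[where ys = "[y, z]"]) auto

lemma evalo_Proj: "i < length xs \<Longrightarrow> evalo Ora (Proj i) xs (xs ! i)"
  using ev_Proj[of Ora i xs] by (simp add: arg_def)

lemma evalo_S: "evalo Ora S [x] (Suc x)"
  using ev_S[of Ora "[x]"] by (simp add: arg_def)

lemma evalo_Prim:
  assumes "evalo Ora f xs (r 0)" and "\<And>n. n < k \<Longrightarrow> evalo Ora g (n # r n # xs) (r (Suc n))"
  shows "evalo Ora (Prim f g) (k # xs) (r k)"
  using assms(2)
proof (induction k)
  case 0 show ?case by (rule ev_Prim0[OF assms(1)])
next
  case (Suc k) then show ?case by (intro ev_PrimS[where r = "r k"]) auto
qed

definition add_prog :: recf where
  "add_prog = Prim (Proj 0) (Comp S [Proj 1])"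

lemma evalo_add: "evalo Ora add_prog [m, n] (m + n)"
  unfolding add_prog_def
proof (rule evalo_Prim[where r = "\<lambda>m. m + n"])
  show "evalo Ora (Proj 0) [n] (0 + n)" using evalo_Proj[of 0 "[n]"] by simp
  fix k show "evalo Ora (Comp S [Proj 1]) [k, k + n, n] (Suc k + n)"
    using evalo_Proj[of 1 "[k, k + n, n]"] evalo_S[of Ora "k + n"] by (auto intro: evalo_Comp1)
qed

definition pred_prog :: recf where
  "pred_prog = Prim Z (Proj 0)"

lemma evalo_pred: "evalo Ora pred_prog [n] (n - 1)"
  unfolding pred_prog_def
proof (rule evalo_Prim[where r = "\<lambda>m. m - 1"])
  show "evalo Ora Z [] (0 - 1)" using ev_Z by simp
  fix k show "evalo Ora (Proj 0) [k, k - 1] (Suc k - 1)" using evalo_Proj[of 0 "[k, k - 1]"] by simp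
qed

definition sub_prog :: recf where
  "sub_prog = Prim (Proj 0) (Comp pred_prog [Proj 1])"

lemma evalo_sub: "evalo Ora sub_prog [m, n] (n - m)"
  unfolding sub_prog_def
proof (rule evalo_Prim[where r = "\<lambda>m. n - m"])
  show "evalo Ora (Proj 0) [n] (n - 0)" using evalo_Proj[of 0 "[n]"] by simp
  fix k show "evalo Ora (Comp pred_prog [Proj 1]) [k, n - k, n] (n - Suc k)"
    using evalo_Proj[of 1 "[k, n - k, n]"] evalo_pred[of Ora "n - k"] by (auto intro: evalo_Comp1)
qed

definition tri_prog :: recf where
  "tri_prog = Prim Z (Comp S [Comp add_prog [Proj 0, Proj 1]])"

lemma evalo_tri: "evalo Ora tri_prog [n] (triangle n)"
  unfolding tri_prog_def
proof (rule evalo_Prim[where r = triangle])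
  show "evalo Ora Z [] (triangle 0)" using ev_Z by simp
  fix k
  have "evalo Ora (Comp S [Comp add_prog [Proj 0, Proj 1]]) [k, triangle k] (Suc (k + triangle k))"
    by (rule evalo_Comp1[OF evalo_Comp2[OF _ _ evalo_add] evalo_S])
      (use evalo_Proj[of 0 "[k, triangle k]"] evalo_Proj[of 1 "[k, triangle k]"] in auto)
  then show "evalo Ora (Comp S [Comp add_prog [Proj 0, Proj 1]]) [k, triangle k] (triangle (Suc k))"
    by (simp add: add.commute)
qed

definition pair_prog :: "recf \<Rightarrow> recf \<Rightarrow> recf" where
  "pair_prog f g = Comp add_prog [Comp tri_prog [Comp add_prog [f, g]], f]"

lemma evalo_pair:
  "evalo Ora f xs a \<Longrightarrow> evalo Ora g xs b \<Longrightarrow> evalo Ora (pair_prog f g) xs (prod_encode (a, b))"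
  unfolding pair_prog_def prod_encode_def prod.case
  by (intro evalo_Comp2[OF _ _ evalo_add] evalo_Comp1[OF _ evalo_tri])

lemma evalo_Mn_Least:
  assumes "\<And>n. evalo Ora f (n # xs) (if P n then 0 else 1)" and "\<exists>n. P n"
  shows "evalo Ora (Mn f) xs (LEAST n. P n)"
proof (rule ev_Mn)
  show "evalo Ora f ((LEAST n. P n) # xs) 0"
    using assms(1)[of "LEAST n. P n"] LeastI_ex[OF assms(2)] by simp
  show "\<forall>m<LEAST n. P n. \<exists>w. w \<noteq> 0 \<and> evalo Ora f (m # xs) w"
  proof (intro allI impI exI[of _ 1] conjI)
    fix m assume "m < (LEAST n. P n)"
    then have "\<not> P m" by (rule not_less_Least)
    with assms(1)[of m] show "evalo Ora f (m # xs) 1" by simp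
  qed simp
qed

text \<open>Inverts Cantor pairing: the code \<open>c\<close> of \<open>(a, b)\<close> is
  \<open>triangle (a + b) + a\<close>, so \<open>a + b\<close> is the least \<open>s\<close> with
  \<open>c < triangle (Suc s)\<close>.\<close>

definition diag_prog :: recf where
  "diag_prog = Mn (Comp sub_prog [Comp tri_prog [Comp S [Proj 0]], Comp S [Proj 1]])"

definition fst_prog :: recf where
  "fst_prog = Comp sub_prog [Comp tri_prog [diag_prog], Proj 0]"

definition snd_prog :: recf where
  "snd_prog = Comp sub_prog [fst_prog, diag_prog]"

lemma triangle_mono: "m \<le> n \<Longrightarrow> triangle m \<le> triangle n"
  by (induction n) (auto simp: le_Suc_eq)

lemma evalo_diag: "evalo Ora diag_prog [prod_encode (a, b)] (a + b)"
proof -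
  let ?c = "prod_encode (a, b)"
  let ?P = "\<lambda>s. Suc ?c \<le> triangle (Suc s)"
  have l: "(LEAST s. ?P s) = a + b"
  proof (rule Least_equality)
    show "?P (a + b)" by (simp add: prod_encode_def)
  next
    fix s assume s: "?P s"
    show "a + b \<le> s"
    proof (rule ccontr)
      assume "\<not> a + b \<le> s"
      then have "triangle (Suc s) \<le> triangle (a + b)" by (intro triangle_mono) auto
      with s show False by (simp add: prod_encode_def del: triangle_Suc)
    qed
  qed
  have "evalo Ora (Comp sub_prog [Comp tri_prog [Comp S [Proj 0]], Comp S [Proj 1]]) [n, ?c]
      (Suc ?c - triangle (Suc n))" for n
    by (intro evalo_Comp2[OF _ _ evalo_sub] evalo_Comp1[OF _ evalo_tri] evalo_Comp1[OF _ evalo_S])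
      (use evalo_Proj[of 0 "[n, ?c]"] evalo_Proj[of 1 "[n, ?c]"] in auto)
  note step = this
  show ?thesis
    unfolding l[symmetric]
  proof -
    have "evalo Ora diag_prog [?c] (LEAST n. Suc ?c - triangle (Suc n) = 0)"
      unfolding diag_prog_def
    proof (rule ev_Mn)
      let ?l = "LEAST n. Suc ?c - triangle (Suc n) = 0"
      have ex: "Suc ?c - triangle (Suc (a + b)) = 0" by (simp add: prod_encode_def)
      have "Suc ?c - triangle (Suc ?l) = 0" by (rule LeastI[where P = "\<lambda>n. Suc ?c - triangle (Suc n) = 0", OF ex])
      then show "evalo Ora (Comp sub_prog [Comp tri_prog [Comp S [Proj 0]], Comp S [Proj 1]]) [?l, ?c] 0"
        using step[of ?l] by simp
      show "\<forall>m<?l. \<exists>w. w \<noteq> 0 \<and> evalo Ora (Comp sub_prog [Comp tri_prog [Comp S [Proj 0]], Comp S [Proj 1]]) [m, ?c] w"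
        using step not_less_Least by blast
    qed
    then show "evalo Ora diag_prog [?c] (LEAST s. ?P s)" by simp
  qed
qed

lemma evalo_fst: "evalo Ora fst_prog [prod_encode (a, b)] a"
proof -
  let ?c = "prod_encode (a, b)"
  have "evalo Ora fst_prog [?c] (?c - triangle (a + b))"
    unfolding fst_prog_def
    by (intro evalo_Comp2[OF _ _ evalo_sub] evalo_Comp1[OF _ evalo_tri] evalo_diag)
      (use evalo_Proj[of 0 "[?c]"] in auto)
  then show ?thesis by (simp add: prod_encode_def)
qed

lemma evalo_snd: "evalo Ora snd_prog [prod_encode (a, b)] b"
proof -
  have "evalo Ora snd_prog [prod_encode (a, b)] (a + b - a)"
    unfolding snd_prog_def by (intro evalo_Comp2[OF _ _ evalo_sub] evalo_fst evalo_diag)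
  then show ?thesis by simp
qed

section \<open>Coded types and closure properties of computable functions\<close>

class ecode =
  fixes ec :: "'a \<Rightarrow> nat"
  assumes ec_inj: "ec x = ec y \<Longrightarrow> x = y"

text \<open>Kept apart from \<open>ecode\<close> because \<open>bool\<close> has only two codes;
  decoding by \<open>dc\<close> needs every number to be a code.\<close>

class ecode_surj = ecode +
  assumes ec_surj: "\<exists>x. ec x = n"

definition dc :: "nat \<Rightarrow> 'a::ecode_surj" where
  "dc n = (SOME x. ec x = n)"

lemma ec_dc [simp]: "ec (dc n) = n"
  unfolding dc_def using ec_surj by (rule someI_ex)

lemma dc_ec [simp]: "dc (ec x) = x"
  by (rule ec_inj) simp

lemma ec_eq_iff [simp]: "ec x = ec y \<longleftrightarrow> x = y"
  using ec_inj by blast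

instantiation nat :: ecode_surj begin
definition ec_nat :: "nat \<Rightarrow> nat" where "ec_nat n = n"
instance by standard (auto simp: ec_nat_def)
end

instantiation bool :: ecode begin
definition ec_bool :: "bool \<Rightarrow> nat" where "ec_bool b = (if b then 1 else 0)"
instance by standard (auto simp: ec_bool_def split: if_splits)
end

instantiation prod :: (ecode, ecode) ecode begin
definition ec_prod :: "'a \<times> 'b \<Rightarrow> nat" where "ec_prod p = prod_encode (ec (fst p), ec (snd p))"
instance by standard (auto simp: ec_prod_def prod_eq_iff)
end

instance prod :: (ecode_surj, ecode_surj) ecode_surj
proof
  fix n
  have "ec ((dc (fst (prod_decode n)), dc (snd (prod_decode n))) :: 'a \<times> 'b) = n"
    by (simp add: ec_prod_def)
  then show "\<exists>x :: 'a \<times> 'b. ec x = n" by blast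
qed

instantiation list :: (ecode) ecode begin
definition ec_list :: "'a list \<Rightarrow> nat" where "ec_list xs = list_encode (map ec xs)"
instance
proof
  fix x y :: "'a list"
  assume "ec x = ec y"
  then have "map ec x = map ec y" by (auto simp: ec_list_def dest: injD[OF inj_list_encode])
  moreover have "inj (ec :: 'a \<Rightarrow> nat)" by (rule injI) simp
  ultimately show "x = y" by (simp add: inj_map_eq_map)
qed
end

instance list :: (ecode_surj) ecode_surj
proof
  fix n
  have "ec (map dc (list_decode n) :: 'a list) = n"
    by (simp add: ec_list_def comp_def)
  then show "\<exists>x :: 'a list. ec x = n" by blast
qed

text \<open>All arguments are packed into one code, so that computability proofs follow the syntax
  of the function through the rules \<open>cf_intros\<close>.\<close>

definition cf :: "nat set \<Rightarrow> ('a::ecode \<Rightarrow> 'b::ecode) \<Rightarrow> bool" where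
  "cf Ora f \<longleftrightarrow> (\<exists>p. \<forall>x. evalo Ora p [ec x] (ec (f x)))"

named_theorems cf_intros

lemma cf_cong: "cf Ora f \<Longrightarrow> (\<And>x. f x = g x) \<Longrightarrow> cf Ora g"
  by (simp add: cf_def)

lemma cf_id [cf_intros]: "cf Ora (\<lambda>x. x)"
  unfolding cf_def using evalo_Proj[of 0] by (metis length_Cons nth_Cons_0 zero_less_Suc)

lemma cf_compose: "cf Ora g \<Longrightarrow> cf Ora f \<Longrightarrow> cf Ora (\<lambda>x. g (f x))"
  unfolding cf_def by (meson evalo_Comp1)

primrec const_prog :: "nat \<Rightarrow> recf" where
  "const_prog 0 = Z"
| "const_prog (Suc n) = Comp S [const_prog n]"

lemma evalo_const: "evalo Ora (const_prog n) xs n"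
  by (induction n) (auto intro: ev_Z evalo_Comp1 evalo_S)

lemma cf_const [cf_intros]: "cf Ora (\<lambda>x. c)"
  unfolding cf_def using evalo_const by blast

lemma cf_Pair [cf_intros]: "cf Ora f \<Longrightarrow> cf Ora g \<Longrightarrow> cf Ora (\<lambda>x. (f x, g x))"
  unfolding cf_def ec_prod_def fst_conv snd_conv by (meson evalo_pair)

lemma cf_fst [cf_intros]: "cf Ora f \<Longrightarrow> cf Ora (\<lambda>x. fst (f x))"
  by (rule cf_compose) (auto simp: cf_def ec_prod_def intro: evalo_fst)

lemma cf_snd [cf_intros]: "cf Ora f \<Longrightarrow> cf Ora (\<lambda>x. snd (f x))"
  by (rule cf_compose) (auto simp: cf_def ec_prod_def intro: evalo_snd)

lemma cf_ec [cf_intros]: "cf Ora f \<Longrightarrow> cf Ora (\<lambda>x. ec (f x))"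
  by (simp add: cf_def ec_nat_def)

lemma cf_dc [cf_intros]: "cf Ora f \<Longrightarrow> cf Ora (\<lambda>x. dc (f x))"
  by (simp add: cf_def ec_nat_def)

lemma cf_nat_cast: "cf Ora (\<lambda>x. ec (f x)) \<Longrightarrow> cf Ora f"
  by (simp add: cf_def ec_nat_def)

lemma cf_Suc [cf_intros]: "cf Ora f \<Longrightarrow> cf Ora (\<lambda>x. Suc (f x))"
  by (rule cf_compose) (auto simp: cf_def ec_nat_def intro: evalo_S)

lemma cf_oracle [cf_intros]: "cf Ora f \<Longrightarrow> cf Ora (\<lambda>x. f x \<in> Ora)"
proof (rule cf_compose[where g = "\<lambda>n. n \<in> Ora"])
  have "evalo Ora Orc [n] (ec (n \<in> Ora))" for n
    using ev_Orc[of Ora "[n]"] by (simp add: arg_def ec_bool_def)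
  then show "cf Ora (\<lambda>n. n \<in> Ora)" by (auto simp: cf_def ec_nat_def)
qed

text \<open>The parameter \<open>x\<close> travels as the last argument of \<open>Prim\<close>. The
  step function is assumed computable in uncurried form, as a function of one triple.\<close>

lemma cf_rec_nat [cf_intros]:
  assumes "cf Ora a" "cf Ora (\<lambda>t. b (fst t) (fst (snd t)) (snd (snd t)))" "cf Ora k"
  shows "cf Ora (\<lambda>x. rec_nat (a x) (\<lambda>n r. b x n r) (k x))"
proof -
  from assms obtain pa pb pk where
    pa: "\<And>x. evalo Ora pa [ec x] (ec (a x))" and
    pb: "\<And>x n r. evalo Ora pb [prod_encode (ec x, prod_encode (n, ec r))] (ec (b x n r))" and
    pk: "\<And>x. evalo Ora pk [ec x] (k x)"
    unfolding cf_def ec_nat_def ec_prod_def by fastforce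
  let ?g = "Comp pb [pair_prog (Proj 2) (pair_prog (Proj 0) (Proj 1))]"
  have "evalo Ora (Comp (Prim pa ?g) [pk, Proj 0]) [ec x] (ec (rec_nat (a x) (\<lambda>n r. b x n r) (k x)))" for x
  proof (rule evalo_Comp2[OF pk])
    show "evalo Ora (Proj 0) [ec x] (ec x)" using evalo_Proj[of 0 "[ec x]"] by simp
    show "evalo Ora (Prim pa ?g) [k x, ec x] (ec (rec_nat (a x) (b x) (k x)))"
    proof (rule evalo_Prim[where r = "\<lambda>k. ec (rec_nat (a x) (b x) k)"])
      show "evalo Ora pa [ec x] (ec (rec_nat (a x) (b x) 0))" using pa by simp
      fix n
      let ?r = "rec_nat (a x) (b x) n"
      have "evalo Ora ?g [n, ec ?r, ec x] (ec (b x n ?r))"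
        by (intro evalo_Comp1[OF _ pb] evalo_pair)
          (use evalo_Proj[of 0 "[n, ec ?r, ec x]"] evalo_Proj[of 1 "[n, ec ?r, ec x]"]
             evalo_Proj[of 2 "[n, ec ?r, ec x]"] in auto)
      then show "evalo Ora ?g [n, ec ?r, ec x] (ec (rec_nat (a x) (b x) (Suc n)))" by simp
    qed
  qed
  then show ?thesis unfolding cf_def by blast
qed

lemma cf_If [cf_intros]:
  assumes "cf Ora P" "cf Ora f" "cf Ora g"
  shows "cf Ora (\<lambda>x. if P x then f x else g x)"
proof -
  \<comment> \<open>The code of a truth value is 0 or 1, so the recursion runs zero times or
    once.\<close>
  have "cf Ora (\<lambda>x. rec_nat (g x) (\<lambda>n r. f x) (ec (P x)))"
    by (intro cf_intros assms cf_compose[OF assms(2)])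
  moreover have "rec_nat (g x) (\<lambda>n r. f x) (ec (P x)) = (if P x then f x else g x)" for x
    by (simp add: ec_bool_def)
  ultimately show ?thesis by simp
qed

lemma cf_not [cf_intros]:
  assumes "cf Ora P" shows "cf Ora (\<lambda>x. \<not> P x)"
proof -
  have "cf Ora (\<lambda>x. if P x then False else True)" by (intro cf_intros assms)
  then show ?thesis by (rule cf_cong) simp
qed

lemma cf_conj [cf_intros]:
  assumes "cf Ora P" "cf Ora Q" shows "cf Ora (\<lambda>x. P x \<and> Q x)"
proof -
  have "cf Ora (\<lambda>x. if P x then Q x else False)" by (intro cf_intros assms)
  then show ?thesis by (rule cf_cong) simp
qed

lemma cf_disj [cf_intros]:
  assumes "cf Ora P" "cf Ora Q" shows "cf Ora (\<lambda>x. P x \<or> Q x)"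
proof -
  have "cf Ora (\<lambda>x. if P x then True else Q x)" by (intro cf_intros assms)
  then show ?thesis by (rule cf_cong) simp
qed

lemma cf_imp [cf_intros]:
  assumes "cf Ora P" "cf Ora Q" shows "cf Ora (\<lambda>x. P x \<longrightarrow> Q x)"
proof -
  have "cf Ora (\<lambda>x. if P x then Q x else True)" by (intro cf_intros assms)
  then show ?thesis by (rule cf_cong) simp
qed

lemma cf_diff [cf_intros]:
  assumes "cf Ora f" "cf Ora g" shows "cf Ora (\<lambda>x. f x - g x :: nat)"
proof -
  from assms obtain p q where "\<And>x. evalo Ora p [ec x] (f x)" "\<And>x. evalo Ora q [ec x] (g x)"
    unfolding cf_def ec_nat_def by blast
  then have "evalo Ora (Comp sub_prog [q, p]) [ec x] (f x - g x)" for x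
    by (intro evalo_Comp2[OF _ _ evalo_sub])
  then show ?thesis unfolding cf_def ec_nat_def by blast
qed

lemma cf_is0: assumes "cf Ora f" shows "cf Ora (\<lambda>x. f x = (0::nat))"
proof -
  have "cf Ora (\<lambda>x. 1 - f x)" by (intro cf_intros assms)
  then have "cf Ora (\<lambda>x. ec (f x = 0))" by (rule cf_cong) (simp add: ec_bool_def)
  then show ?thesis by (rule cf_nat_cast)
qed

lemma cf_le [cf_intros]:
  assumes "cf Ora f" "cf Ora g" shows "cf Ora (\<lambda>x. f x \<le> (g x :: nat))"
proof -
  have "cf Ora (\<lambda>x. f x - g x = 0)" by (intro cf_is0 cf_intros assms)
  then show ?thesis by simp
qed

lemma cf_less [cf_intros]:
  assumes "cf Ora f" "cf Ora g" shows "cf Ora (\<lambda>x. f x < (g x :: nat))"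
proof -
  have "cf Ora (\<lambda>x. Suc (f x) \<le> g x)" by (intro cf_intros assms)
  then show ?thesis by (simp add: Suc_le_eq)
qed

lemma cf_eq [cf_intros]:
  assumes "cf Ora f" "cf Ora g" shows "cf Ora (\<lambda>x. f x = g x)"
proof -
  have "cf Ora (\<lambda>x. ec (f x) \<le> ec (g x) \<and> ec (g x) \<le> ec (f x))" by (intro cf_intros assms)
  moreover have "(ec (f x) \<le> ec (g x) \<and> ec (g x) \<le> ec (f x)) = (f x = g x)" for x
    by (auto simp: eq_iff[symmetric])
  ultimately show ?thesis by simp
qed

lemma cf_prod_encode [cf_intros]:
  assumes "cf Ora f" "cf Ora g" shows "cf Ora (\<lambda>x. prod_encode (f x, g x))"
proof -
  have "cf Ora (\<lambda>x. ec (f x, g x))" by (intro cf_intros assms)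
  then show ?thesis by (simp add: ec_prod_def ec_nat_def)
qed

lemma cf_prod_decode [cf_intros]:
  assumes "cf Ora f" shows "cf Ora (\<lambda>x. prod_decode (f x))"
proof -
  have "cf Ora (\<lambda>x. dc (f x) :: nat \<times> nat)" by (intro cf_intros assms)
  moreover have "(dc n :: nat \<times> nat) = prod_decode n" for n
    by (rule ec_inj) (simp, simp add: ec_prod_def ec_nat_def)
  ultimately show ?thesis by simp
qed

lemma cf_list_decode [cf_intros]:
  assumes "cf Ora f" shows "cf Ora (\<lambda>x. list_decode (f x))"
proof -
  have m: "map ec xs = xs" for xs :: "nat list"
    by (rule map_idI) (simp add: ec_nat_def)
  have d: "(dc n :: nat list) = list_decode n" for n
  proof -
    have "ec (dc n :: nat list) = n" by (rule ec_dc)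
    then have "list_encode (dc n) = n" by (simp only: ec_list_def m)
    then show ?thesis by (metis list_encode_inverse)
  qed
  have "cf Ora (\<lambda>x. dc (f x) :: nat list)" by (intro cf_intros assms)
  then show ?thesis by (simp only: d)
qed

lemma ec_Nil [simp]: "ec [] = 0"
  and ec_Cons [simp]: "ec (x # xs) = Suc (prod_encode (ec x, ec xs))"
  by (simp_all add: ec_list_def)

lemma cf_Cons [cf_intros]:
  assumes "cf Ora f" "cf Ora g" shows "cf Ora (\<lambda>x. f x # g x)"
proof -
  have "cf Ora (\<lambda>x. Suc (prod_encode (ec (f x), ec (g x))))" by (intro cf_intros assms)
  then show ?thesis using cf_nat_cast[of Ora "\<lambda>x. f x # g x"] by simp
qed

text \<open>The predecessor of the code of \<open>y # ys\<close> codes the pair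
  \<open>(y, ys)\<close>. The recursion ignores its previous value, so any positive number of rounds
  yields the second branch.\<close>

lemma cf_case_list [cf_intros]:
  assumes "cf Ora l" "cf Ora a" "cf Ora (\<lambda>t. b (fst t) (fst (snd t)) (snd (snd t)))"
  shows "cf Ora (\<lambda>x. case l x of [] \<Rightarrow> a x | y # ys \<Rightarrow> b x y ys)"
proof -
  from assms obtain pa pb pl where
    pa: "\<And>x. evalo Ora pa [ec x] (ec (a x))" and
    pb: "\<And>x y ys. evalo Ora pb [prod_encode (ec x, prod_encode (ec y, ec ys))] (ec (b x y ys))" and
    pl: "\<And>x. evalo Ora pl [ec x] (ec (l x))"
    unfolding cf_def ec_prod_def by fastforce
  let ?g = "Comp (Comp pb [pair_prog (Proj 0) (Comp pred_prog [pl])]) [Proj 2]"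
  have "evalo Ora (Comp (Prim pa ?g) [pl, Proj 0]) [ec x] (ec (case l x of [] \<Rightarrow> a x | y # ys \<Rightarrow> b x y ys))" for x
  proof (rule evalo_Comp2[OF pl])
    show "evalo Ora (Proj 0) [ec x] (ec x)" using evalo_Proj[of 0 "[ec x]"] by simp
    show "evalo Ora (Prim pa ?g) [ec (l x), ec x] (ec (case l x of [] \<Rightarrow> a x | y # ys \<Rightarrow> b x y ys))"
    proof (cases "l x")
      case Nil
      then show ?thesis using pa by (auto intro: ev_Prim0)
    next
      case (Cons y ys)
      let ?v = "ec (b x y ys)"
      have step: "evalo Ora ?g [n, r, ec x] ?v" for n r
      proof (rule evalo_Comp1[where y = "ec x"])
        show "evalo Ora (Proj 2) [n, r, ec x] (ec x)" using evalo_Proj[of 2 "[n, r, ec x]"] by simp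
        have "evalo Ora (Comp pred_prog [pl]) [ec x] (ec (l x) - 1)"
          by (rule evalo_Comp1[OF pl evalo_pred])
        then show "evalo Ora (Comp pb [pair_prog (Proj 0) (Comp pred_prog [pl])]) [ec x] ?v"
          using evalo_Proj[of 0 "[ec x]"] Cons by (intro evalo_Comp1[OF _ pb] evalo_pair) auto
      qed
      have "evalo Ora (Prim pa ?g) [ec (l x), ec x] (if ec (l x) = 0 then ec (a x) else ?v)"
        by (rule evalo_Prim[where r = "\<lambda>n. if n = 0 then ec (a x) else ?v"]) (use pa step in auto)
      then show ?thesis using Cons by simp
    qed
  qed
  then show ?thesis unfolding cf_def by blast
qed

lemma length_le_ec: "length l \<le> ec l"
proof (induction l)
  case (Cons x l)
  then show ?case using le_prod_encode_2[of "ec l" "ec x"] by simp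
qed simp

text \<open>One element is consumed per round. The code of a list bounds its length, and surplus
  rounds idle on the empty list.\<close>

lemma cf_foldl [cf_intros]:
  assumes "cf Ora a" "cf Ora (\<lambda>t. b (fst t) (fst (snd t)) (snd (snd t)))" "cf Ora l"
  shows "cf Ora (\<lambda>x. foldl (b x) (a x) (l x))"
proof -
  let ?s = "\<lambda>x p. case snd p of [] \<Rightarrow> p | y # ys \<Rightarrow> (b x (fst p) y, ys)"
  have sb: "cf Ora (\<lambda>t. b (f t) (g t) (h t))" if "cf Ora f" "cf Ora g" "cf Ora h" for f g and h :: "'z::ecode \<Rightarrow> _"
    using cf_compose[OF assms(2) cf_Pair[OF that(1) cf_Pair[OF that(2,3)]]] by simp
  have "cf Ora (\<lambda>x. fst (rec_nat (a x, l x) (\<lambda>n r. ?s x r) (ec (l x))))"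
    by (intro cf_intros sb assms)
  moreover have "fst (rec_nat (r, l) (\<lambda>n r. ?s x r) k) = foldl (b x) r l" if "length l \<le> k" for x r l k
  proof -
    have n: "rec_nat (r, []) (\<lambda>n r. ?s x r) k = (r, [])" for r k by (induction k) auto
    have shift: "rec_nat p (\<lambda>n r. ?s x r) (Suc k) = rec_nat (?s x p) (\<lambda>n r. ?s x r) k" for p k
      by (induction k) auto
    from that show ?thesis
    proof (induction l arbitrary: r k)
      case Nil then show ?case using n by simp
    next
      case (Cons y l)
      then obtain k' where k: "k = Suc k'" "length l \<le> k'" by (cases k) auto
      show ?case unfolding k(1) shift using Cons.IH[OF k(2)] by simp
    qed
  qed
  ultimately show ?thesis by (rule cf_cong) (use length_le_ec in blast)
qed

lemma cf_rev [cf_intros]: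
  assumes "cf Ora l" shows "cf Ora (\<lambda>x. rev (l x))"
proof -
  have "cf Ora (\<lambda>x. foldl (\<lambda>r y. y # r) [] (l x))" by (intro cf_intros assms)
  moreover have "foldl (\<lambda>r y. y # r) r l = rev l @ r" for r and l :: "'b list"
    by (induction l arbitrary: r) auto
  ultimately show ?thesis by simp
qed

text \<open>A fold over the reversed list that carries along the tail already treated.\<close>

lemma cf_rec_list [cf_intros]:
  assumes "cf Ora a"
    "cf Ora (\<lambda>t. b (fst t) (fst (snd t)) (fst (snd (snd t))) (snd (snd (snd t))))" "cf Ora l"
  shows "cf Ora (\<lambda>x. rec_list (a x) (b x) (l x))"
proof -
  have sb: "cf Ora (\<lambda>t. b (f t) (g t) (h t) (k t))"
    if "cf Ora f" "cf Ora g" "cf Ora h" "cf Ora k" for f g h and k :: "'z::ecode \<Rightarrow> _"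
    using cf_compose[OF assms(2) cf_Pair[OF that(1) cf_Pair[OF that(2) cf_Pair[OF that(3,4)]]]] by simp
  have "cf Ora (\<lambda>x. snd (foldl (\<lambda>p y. (y # fst p, b x y (fst p) (snd p))) ([], a x) (rev (l x))))"
    by (intro cf_intros sb assms)
  moreover have "foldl (\<lambda>p y. (y # fst p, b x y (fst p) (snd p))) ([], a x) (rev l) = (l, rec_list (a x) (b x) l)"
    for x l by (induction l) auto
  ultimately show ?thesis by simp
qed

lemma cf_comp2: "cf Ora (\<lambda>t. F (fst t) (snd t)) \<Longrightarrow> cf Ora a \<Longrightarrow> cf Ora b \<Longrightarrow> cf Ora (\<lambda>x. F (a x) (b x))"
  by (drule cf_compose[OF _ cf_Pair[of Ora a b]]; simp add: cf_Pair)

lemma cf_comp3: "cf Ora (\<lambda>t. F (fst t) (fst (snd t)) (snd (snd t))) \<Longrightarrow> cf Ora a \<Longrightarrow> cf Ora b \<Longrightarrow> cf Ora c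
    \<Longrightarrow> cf Ora (\<lambda>x. F (a x) (b x) (c x))"
  by (drule cf_compose[OF _ cf_Pair[of Ora a "\<lambda>x. (b x, c x)"]]; simp add: cf_Pair)

lemma cf_comp4: "cf Ora (\<lambda>t. F (fst t) (fst (snd t)) (fst (snd (snd t))) (snd (snd (snd t)))) \<Longrightarrow> cf Ora a
    \<Longrightarrow> cf Ora b \<Longrightarrow> cf Ora c \<Longrightarrow> cf Ora d \<Longrightarrow> cf Ora (\<lambda>x. F (a x) (b x) (c x) (d x))"
  by (drule cf_compose[OF _ cf_Pair[of Ora a "\<lambda>x. (b x, c x, d x)"]]; simp add: cf_Pair)

lemma cf_length [cf_intros]:
  assumes "cf Ora l" shows "cf Ora (\<lambda>x. length (l x))"
proof -
  have "cf Ora (\<lambda>x. rec_list 0 (\<lambda>y ys r. Suc r) (l x))" by (intro cf_intros assms)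
  moreover have "rec_list 0 (\<lambda>y ys r. Suc r) l = length l" for l :: "'b list" by (induction l) auto
  ultimately show ?thesis by simp
qed

lemma cf_append [cf_intros]:
  assumes "cf Ora l" "cf Ora k" shows "cf Ora (\<lambda>x. l x @ k x)"
proof -
  have "cf Ora (\<lambda>x. rec_list (k x) (\<lambda>y ys r. y # r) (l x))" by (intro cf_intros assms)
  moreover have "rec_list k (\<lambda>y ys r. y # r) l = l @ k" for l k :: "'b list" by (induction l) auto
  ultimately show ?thesis by simp
qed

lemma cf_map [cf_intros]:
  assumes "cf Ora (\<lambda>t. f (fst t) (snd t))" "cf Ora l" shows "cf Ora (\<lambda>x. map (f x) (l x))"
proof -
  have "cf Ora (\<lambda>x. rec_list [] (\<lambda>y ys r. f x y # r) (l x))" by (intro cf_intros cf_comp2[OF assms(1)] assms(2))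
  moreover have "rec_list [] (\<lambda>y ys r. f x y # r) l = map (f x) l" for x l by (induction l) auto
  ultimately show ?thesis by simp
qed

lemma cf_Ball [cf_intros]:
  assumes "cf Ora l" "cf Ora (\<lambda>t. P (fst t) (snd t))" shows "cf Ora (\<lambda>x. \<forall>y\<in>set (l x). P x y)"
proof -
  have "cf Ora (\<lambda>x. rec_list True (\<lambda>y ys r. P x y \<and> r) (l x))" by (intro cf_intros cf_comp2[OF assms(2)] assms(1))
  moreover have "rec_list True (\<lambda>y ys r. P x y \<and> r) l = (\<forall>y\<in>set l. P x y)" for x l by (induction l) auto
  ultimately show ?thesis by simp
qed

lemma cf_Bex [cf_intros]:
  assumes "cf Ora l" "cf Ora (\<lambda>t. P (fst t) (snd t))" shows "cf Ora (\<lambda>x. \<exists>y\<in>set (l x). P x y)"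
proof -
  have "cf Ora (\<lambda>x. \<not> (\<forall>y\<in>set (l x). \<not> P x y))" by (intro cf_intros assms)
  then show ?thesis by simp
qed

lemma cf_member [cf_intros]:
  assumes "cf Ora f" "cf Ora l" shows "cf Ora (\<lambda>x. f x \<in> set (l x))"
proof -
  have "cf Ora (\<lambda>x. \<exists>y\<in>set (l x). y = f x)" by (intro cf_intros assms cf_compose[OF assms(1)])
  then show ?thesis by simp
qed

lemma cf_tl [cf_intros]:
  assumes "cf Ora l" shows "cf Ora (\<lambda>x. tl (l x))"
proof -
  have "cf Ora (\<lambda>x. case l x of [] \<Rightarrow> [] | y # ys \<Rightarrow> ys)" by (intro cf_intros assms)
  then show ?thesis by (simp add: tl_def)
qed

lemma cf_upt [cf_intros]:
  assumes "cf Ora f" shows "cf Ora (\<lambda>x. [0..<f x])"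
proof -
  have "cf Ora (\<lambda>x. rec_nat [] (\<lambda>n r. r @ [n]) (f x))" by (intro cf_intros assms)
  moreover have "rec_nat [] (\<lambda>n r. r @ [n]) n = [0..<n]" for n by (induction n) auto
  ultimately show ?thesis by simp
qed

lemma cf_all_less [cf_intros]:
  assumes "cf Ora f" "cf Ora (\<lambda>t. P (fst t) (snd t))" shows "cf Ora (\<lambda>x. \<forall>i<(f x :: nat). P x i)"
proof -
  have "cf Ora (\<lambda>x. \<forall>i\<in>set [0..<f x]. P x i)" by (intro cf_intros assms)
  then show ?thesis by (rule cf_cong) auto
qed

lemma cf_ex_less [cf_intros]:
  assumes "cf Ora f" "cf Ora (\<lambda>t. P (fst t) (snd t))" shows "cf Ora (\<lambda>x. \<exists>i<(f x :: nat). P x i)"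
proof -
  have "cf Ora (\<lambda>x. \<exists>i\<in>set [0..<f x]. P x i)" by (intro cf_intros assms)
  then show ?thesis by (rule cf_cong) auto
qed

text \<open>Unbounded search; the second assumption keeps it total, as \<open>cf\<close>
  requires.\<close>

lemma cf_Least [cf_intros]:
  assumes "cf Ora (\<lambda>t. P (fst t) (snd t))" "\<And>x. \<exists>y. P x y"
  shows "cf Ora (\<lambda>x. LEAST y::nat. P x y)"
proof -
  have "cf Ora (\<lambda>t. \<not> P (fst t) (snd t))" by (intro cf_intros assms)
  then obtain p where p: "\<And>x y. evalo Ora p [prod_encode (ec x, y)] (ec (\<not> P x y))"
    unfolding cf_def ec_prod_def ec_nat_def by fastforce
  have "evalo Ora (Mn (Comp p [pair_prog (Proj 1) (Proj 0)])) [ec x] (LEAST y. P x y)" for x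
  proof (rule evalo_Mn_Least)
    fix n
    have "evalo Ora (Comp p [pair_prog (Proj 1) (Proj 0)]) [n, ec x] (ec (\<not> P x n))"
      by (intro evalo_Comp1[OF _ p] evalo_pair)
        (use evalo_Proj[of 0 "[n, ec x]"] evalo_Proj[of 1 "[n, ec x]"] in auto)
    then show "evalo Ora (Comp p [pair_prog (Proj 1) (Proj 0)]) [n, ec x] (if P x n then 0 else 1)"
      by (simp add: ec_bool_def split: if_splits)
  qed (rule assms(2))
  then show ?thesis unfolding cf_def ec_nat_def by blast
qed

lemma cf_drop [cf_intros]:
  assumes "cf Ora l" "cf Ora i" shows "cf Ora (\<lambda>x. drop (i x) (l x))"
proof -
  have "cf Ora (\<lambda>x. rec_nat (l x) (\<lambda>n r. tl r) (i x))" by (intro cf_intros assms)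
  moreover have "rec_nat l (\<lambda>n r. tl r) i = drop i l" for i and l :: "'b list"
    by (induction i) (auto simp: drop_Suc tl_drop)
  ultimately show ?thesis by simp
qed

definition nthd :: "'a \<Rightarrow> 'a list \<Rightarrow> nat \<Rightarrow> 'a" where
  "nthd z xs i = (if i < length xs then xs ! i else z)"

lemma cf_nthd [cf_intros]:
  assumes "cf Ora z" "cf Ora l" "cf Ora i" shows "cf Ora (\<lambda>x. nthd (z x) (l x) (i x))"
proof -
  have "cf Ora (\<lambda>x. case drop (i x) (l x) of [] \<Rightarrow> z x | y # ys \<Rightarrow> y)" by (intro cf_intros assms)
  moreover have "(case drop i l of [] \<Rightarrow> z | y # ys \<Rightarrow> y) = nthd z l i" for i z and l :: "'b list"
    by (auto simp: nthd_def Cons_nth_drop_Suc[symmetric])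
  ultimately show ?thesis by simp
qed

lemma cf_arg [cf_intros]:
  assumes "cf Ora l" "cf Ora i" shows "cf Ora (\<lambda>x. arg (l x) (i x))"
proof -
  have "cf Ora (\<lambda>x. nthd 0 (l x) (i x))" by (intro cf_intros assms)
  then show ?thesis by (simp add: nthd_def arg_def)
qed

definition mem :: "bool list \<Rightarrow> nat \<Rightarrow> bool" where
  "mem s x \<longleftrightarrow> x < length s \<and> s ! x"

lemma cf_mem [cf_intros]:
  assumes "cf Ora s" "cf Ora i" shows "cf Ora (\<lambda>x. mem (s x) (i x))"
proof -
  have "cf Ora (\<lambda>x. nthd False (s x) (i x))" by (intro cf_intros assms)
  then show ?thesis by (rule cf_cong) (simp add: nthd_def mem_def)
qed

definition res :: "nat set \<Rightarrow> nat \<Rightarrow> bool list" where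
  "res X m = map (\<lambda>x. x \<in> X) [0..<m]"

lemma length_res [simp]: "length (res X m) = m"
  by (simp add: res_def)

lemma mem_res [simp]: "mem (res X m) x \<longleftrightarrow> x < m \<and> x \<in> X"
  by (auto simp: mem_def res_def)

lemma cf_res [cf_intros]:
  assumes "cf Ora (\<lambda>t. snd t \<in> X (fst t))" "cf Ora m" shows "cf Ora (\<lambda>x. res (X x) (m x))"
proof -
  have "cf Ora (\<lambda>x. map (\<lambda>y. y \<in> X x) [0..<m x])" by (intro cf_intros assms)
  then show ?thesis by (simp add: res_def)
qed

subsection \<open>Enumerability of the halting computations\<close>

lemma encode_eq_iff [simp]: "encode f = encode g \<longleftrightarrow> f = g"
proof (induction f arbitrary: g)
  case (Comp f gs)
  have gs: "map encode gs = map encode hs \<longleftrightarrow> gs = hs" for hs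
    using Comp.IH(2)
  proof (induction gs arbitrary: hs)
    case (Cons a gs) then show ?case by (cases hs) auto
  qed auto
  show ?case by (cases g) (auto simp: Comp.IH(1) gs inj_list_encode[THEN inj_eq])
qed (case_tac g; auto)+

text \<open>A derivation is a list of judgements (program code, arguments, value), each of which follows
  by one evaluation rule from later entries of the list.\<close>

definition just :: "bool list \<Rightarrow> nat \<times> nat list \<times> nat \<Rightarrow> (nat \<times> nat list \<times> nat) list \<Rightarrow> bool" where
  "just s j d \<longleftrightarrow> (let e = fst j; xs = fst (snd j); v = snd (snd j);
      t = fst (prod_decode e); a = snd (prod_decode e);
      f = fst (prod_decode a); g = snd (prod_decode a) in
    t = 0 \<and> v = 0 \<or> t = 1 \<and> v = Suc (arg xs 0) \<or> t = 2 \<and> v = arg xs a \<or>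
    t = 3 \<and> arg xs 0 < length s \<and> v = (if mem s (arg xs 0) then 1 else 0) \<or>
    t = 4 \<and> (\<exists>k\<in>set d. fst k = f \<and> snd (snd k) = v \<and> length (fst (snd k)) = length (list_decode g) \<and>
      (\<forall>i<length (list_decode g). (arg (list_decode g) i, xs, arg (fst (snd k)) i) \<in> set d)) \<or>
    t = 5 \<and> xs \<noteq> [] \<and> arg xs 0 = 0 \<and> (f, tl xs, v) \<in> set d \<or>
    t = 5 \<and> xs \<noteq> [] \<and> 0 < arg xs 0 \<and> (\<exists>k\<in>set d. fst k = e \<and> fst (snd k) = (arg xs 0 - 1) # tl xs \<and>
      (g, (arg xs 0 - 1) # snd (snd k) # tl xs, v) \<in> set d) \<or>
    t = 6 \<and> (a, v # xs, 0) \<in> set d \<and>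
      (\<forall>m<v. \<exists>k\<in>set d. fst k = a \<and> fst (snd k) = m # xs \<and> snd (snd k) \<noteq> 0))"

primrec chk :: "bool list \<Rightarrow> (nat \<times> nat list \<times> nat) list \<Rightarrow> bool" where
  "chk s [] \<longleftrightarrow> True"
| "chk s (j # d) \<longleftrightarrow> just s j d \<and> chk s d"

text \<open>\<open>E e s n v\<close>: program \<open>e\<close> with input \<open>n\<close> outputs \<open>v\<close> using only the part of the oracle recorded in
  the string \<open>s\<close>. All quantifiers are bounded by the length of \<open>s\<close>, which makes the relation decidable.\<close>

definition E :: "nat \<Rightarrow> bool list \<Rightarrow> nat \<Rightarrow> nat \<Rightarrow> bool" where
  "E e s n v \<longleftrightarrow> n < length s \<and> v < length s \<and> (\<exists>d<length s. chk s (dc d) \<and> (e, [n], v) \<in> set (dc d))"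

lemma cf_just: "cf Ora (\<lambda>t. just (fst t) (fst (snd t)) (snd (snd t)))"
  unfolding just_def Let_def by (intro cf_intros)

lemma cf_chk: "cf Ora (\<lambda>t. chk (fst t) (snd t))"
proof -
  have "cf Ora (\<lambda>t. rec_list True (\<lambda>j d r. just (fst t) j d \<and> r) (snd t))"
    by (intro cf_intros cf_comp3[OF cf_just])
  moreover have "rec_list True (\<lambda>j d r. just s j d \<and> r) d = chk s d" for s d by (induction d) auto
  ultimately show ?thesis by simp
qed

lemma cf_E [cf_intros]:
  "cf Ora e \<Longrightarrow> cf Ora s \<Longrightarrow> cf Ora n \<Longrightarrow> cf Ora v \<Longrightarrow> cf Ora (\<lambda>x. E (e x) (s x) (n x) (v x))"
  by (rule cf_comp4) (unfold E_def, intro cf_intros cf_comp2[OF cf_chk])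

text \<open>All clauses use the derivation positively, and the oracle clause queries only below the
  length of \<open>s\<close>.\<close>

lemma just_mono:
  assumes "just s j d" "set d \<subseteq> set d'" "length s \<le> length s'" "\<And>x. x < length s \<Longrightarrow> mem s' x \<longleftrightarrow> mem s x"
  shows "just s' j d'"
  using assms(1) unfolding just_def Let_def
  apply (elim disj_forward)
  subgoal .
  subgoal .
  subgoal .
  subgoal using assms(3,4) by (auto simp: less_le_trans)
  subgoal using assms(2) by (elim conj_forward) (assumption, blast)
  subgoal using assms(2) by auto
  subgoal using assms(2) by (elim conj_forward) (assumption, assumption, assumption, blast)
  subgoal using assms(2) by (elim conj_forward) (assumption, blast, meson subsetD)
  done

lemma chk_mono:
  assumes "chk s d" "length s \<le> length s'" "\<And>x. x < length s \<Longrightarrow> mem s' x \<longleftrightarrow> mem s x"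
  shows "chk s' d"
  using assms(1) by (induction d) (auto intro: just_mono[OF _ subset_refl assms(2,3)])

lemma chk_append: "chk s d \<Longrightarrow> chk s d' \<Longrightarrow> chk s (d @ d')"
  by (induction d) (auto intro: just_mono)

lemma mem_prefix: "prefix s s' \<Longrightarrow> x < length s \<Longrightarrow> mem s' x \<longleftrightarrow> mem s x"
  by (auto simp: prefix_def mem_def nth_append)

lemma E_mono: "E e s n v \<Longrightarrow> prefix s s' \<Longrightarrow> E e s' n v"
  unfolding E_def using chk_mono[of s _ s'] prefix_length_le[of s s'] mem_prefix[of s s']
  by (metis order_less_le_trans)

text \<open>The head of a derivation is justified by its tail alone, so induction on the list
  applies, with one evaluation rule per program constructor.\<close>

lemma chk_sound:
  assumes "\<And>x. x < length s \<Longrightarrow> mem s x \<longleftrightarrow> x \<in> X"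
  shows "chk s d \<Longrightarrow> (encode f, xs, v) \<in> set d \<Longrightarrow> evalo X f xs v"
proof (induction d arbitrary: f xs v)
  case (Cons j d)
  show ?case
  proof (cases "(encode f, xs, v) = j")
    case False then show ?thesis using Cons by auto
  next
    case True
    then have J: "just s (encode f, xs, v) d" using Cons.prems by simp
    have IH: "\<And>f xs v. (encode f, xs, v) \<in> set d \<Longrightarrow> evalo X f xs v" using Cons by auto
    show ?thesis
    proof (cases f)
      case Z then show ?thesis using J by (auto simp: just_def Let_def intro: ev_Z)
    next
      case S then show ?thesis using J by (auto simp: just_def Let_def intro: ev_S)
    next
      case Proj then show ?thesis using J by (auto simp: just_def Let_def intro: ev_Proj)
    next
      case Orc
      then show ?thesis using J assms[of "arg xs 0"] ev_Orc[of X xs] by (auto simp: just_def Let_def)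
    next
      case (Comp h gs)
      with J obtain ys where "(encode h, ys, v) \<in> set d" and l: "length ys = length gs"
        and i: "\<And>i. i < length gs \<Longrightarrow> (encode (gs ! i), xs, ys ! i) \<in> set d"
        by (auto simp: just_def Let_def arg_def)
      then have "evalo X h ys v" using IH by blast
      moreover have "list_all2 (\<lambda>g y. evalo X g xs y) gs ys"
        using l i IH by (auto simp: list_all2_conv_all_nth)
      ultimately show ?thesis unfolding Comp by (rule ev_Comp[rotated])
    next
      case (Prim h g)
      with J consider xs' where "xs = 0 # xs'" "(encode h, xs', v) \<in> set d"
        | n xs' r where "xs = Suc n # xs'" "(encode f, n # xs', r) \<in> set d" "(encode g, n # r # xs', v) \<in> set d"
        by (cases xs; cases "hd xs") (auto simp: just_def Let_def arg_def)
      then show ?thesis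
      proof cases
        case 1 then show ?thesis using IH Prim by (auto intro: ev_Prim0)
      next
        case 2
        have "evalo X (Prim h g) (n # xs') r" using IH[OF 2(2)] Prim by simp
        then show ?thesis unfolding Prim 2(1) using IH[OF 2(3)] by (rule ev_PrimS)
      qed
    next
      case (Mn h)
      with J have 1: "(encode h, v # xs, 0) \<in> set d"
        and 2: "\<And>m. m < v \<Longrightarrow> \<exists>w. w \<noteq> 0 \<and> (encode h, m # xs, w) \<in> set d"
        by (auto simp: just_def Let_def) (metis prod.collapse)
      show ?thesis unfolding Mn
        by (rule ev_Mn) (use 1 2 IH in blast)+
    qed
  qed
qed simp

text \<open>Validity for all sufficiently long oracle strings lets finitely many derivations be
  concatenated over a common string.\<close>

definition derivable :: "nat set \<Rightarrow> nat \<times> nat list \<times> nat \<Rightarrow> bool" where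
  "derivable X j \<longleftrightarrow> (\<exists>d k. j \<in> set d \<and> (\<forall>m\<ge>k. chk (res X m) d))"

lemma derivable_list:
  "\<forall>j\<in>set js. derivable X j \<Longrightarrow> \<exists>d k. set js \<subseteq> set d \<and> (\<forall>m\<ge>k. chk (res X m) d)"
proof (induction js)
  case Nil show ?case by (rule exI[of _ "[]"]) simp
next
  case (Cons j js)
  then obtain d k d' k' where "set js \<subseteq> set d" "\<forall>m\<ge>k. chk (res X m) d" "j \<in> set d'" "\<forall>m\<ge>k'. chk (res X m) d'"
    unfolding derivable_def by auto
  then have "set (j # js) \<subseteq> set (d @ d') \<and> (\<forall>m\<ge>max k k'. chk (res X m) (d @ d'))"
    by (auto intro: chk_append)
  then show ?case by blast
qed

lemma derivable_step:
  assumes "\<forall>j\<in>set js. derivable X j" "\<And>d m. set js \<subseteq> set d \<Longrightarrow> k0 \<le> m \<Longrightarrow> just (res X m) j d"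
  shows "derivable X j"
proof -
  obtain d k where "set js \<subseteq> set d" "\<forall>m\<ge>k. chk (res X m) d" using derivable_list[OF assms(1)] by blast
  then have "\<forall>m\<ge>max k k0. chk (res X m) (j # d)" using assms(2) by auto
  then show ?thesis unfolding derivable_def by (meson list.set_intros(1))
qed

lemma evalo_derivable: "evalo X f xs v \<Longrightarrow> derivable X (encode f, xs, v)"
proof (induction rule: evalo.induct)
  case (ev_Z xs) show ?case by (rule derivable_step[of "[]"]) (auto simp: just_def)
next
  case (ev_S xs) show ?case by (rule derivable_step[of "[]"]) (auto simp: just_def)
next
  case (ev_Proj i xs) show ?case by (rule derivable_step[of "[]"]) (auto simp: just_def)
next
  case (ev_Orc xs) show ?case
    by (rule derivable_step[of "[]" _ "Suc (arg xs 0)"]) (auto simp: just_def)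
next
  case (ev_Comp xs gs ys f v)
  let ?js = "(encode f, ys, v) # map (\<lambda>i. (encode (gs ! i), xs, ys ! i)) [0..<length gs]"
  have l: "length ys = length gs" using ev_Comp(1) by (simp add: list_all2_lengthD)
  show ?case
  proof (rule derivable_step[of ?js])
    show "\<forall>j\<in>set ?js. derivable X j" using ev_Comp by (auto simp: list_all2_conv_all_nth)
    fix d m assume "set ?js \<subseteq> set d"
    then have "(encode f, ys, v) \<in> set d" "\<forall>i<length gs. (encode (gs ! i), xs, ys ! i) \<in> set d" by auto
    then show "just (res X m) (encode (Comp f gs), xs, v) d"
      using l by (auto simp: just_def Let_def arg_def intro!: bexI[of _ "(encode f, ys, v)"])
  qed
next
  case (ev_Prim0 f xs v g) then show ?case
    by (intro derivable_step[of "[(encode f, xs, v)]"]) (auto simp: just_def Let_def arg_def)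
next
  case (ev_PrimS f g n xs r v) then show ?case
    by (intro derivable_step[of "[(encode (Prim f g), n # xs, r), (encode g, n # r # xs, v)]"])
      (auto simp: just_def Let_def arg_def intro!: bexI[of _ "(encode (Prim f g), n # xs, r)"])
next
  case (ev_Mn f n xs)
  then obtain w where w: "\<And>m. m < n \<Longrightarrow> w m \<noteq> 0 \<and> derivable X (encode f, m # xs, w m)" by metis
  let ?js = "(encode f, n # xs, 0) # map (\<lambda>m. (encode f, m # xs, w m)) [0..<n]"
  show ?case
  proof (rule derivable_step[of ?js])
    show "\<forall>j\<in>set ?js. derivable X j" using w ev_Mn by auto
    fix d m assume "set ?js \<subseteq> set d"
    then have 1: "(encode f, n # xs, 0) \<in> set d" and "\<forall>i<n. (encode f, i # xs, w i) \<in> set d" by auto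
    then have "\<forall>i<n. \<exists>k\<in>set d. fst k = encode f \<and> fst (snd k) = i # xs \<and> snd (snd k) \<noteq> 0"
      using w by (metis fst_conv snd_conv)
    with 1 show "just (res X m) (encode (Mn f), xs, n) d"
      by (simp add: just_def)
  qed
qed

lemma E_iff: "(\<exists>m. E (encode f) (res X m) n v) \<longleftrightarrow> evalo X f [n] v"
proof
  assume "\<exists>m. E (encode f) (res X m) n v"
  then obtain m d where "chk (res X m) d" "(encode f, [n], v) \<in> set d" unfolding E_def by blast
  then show "evalo X f [n] v" by (rule chk_sound[rotated]) simp
next
  assume "evalo X f [n] v"
  then obtain d k where d: "(encode f, [n], v) \<in> set d" "\<forall>m\<ge>k. chk (res X m) d"
    using evalo_derivable unfolding derivable_def by blast
  \<comment> \<open>The string must exceed the code of the derivation, the input and the value,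
    besides being long enough for the oracle queries.\<close>
  let ?m = "Suc (ec d + k + n + v)"
  have "E (encode f) (res X ?m) n v"
    unfolding E_def using d by (auto intro!: exI[of _ "ec d"])
  then show "\<exists>m. E (encode f) (res X m) n v" ..
qed

section \<open>Searches as halting problems\<close>

lemma cf_encode_const: "cf Ora (\<lambda>n. encode (const_prog n))"
proof -
  have "cf Ora (\<lambda>n. rec_nat (encode Z) (\<lambda>n r. prod_encode (4, prod_encode (encode S, Suc (prod_encode (r, 0))))) n)"
    by (intro cf_intros)
  moreover have "rec_nat (encode Z) (\<lambda>n r. prod_encode (4, prod_encode (encode S, Suc (prod_encode (r, 0))))) n
      = encode (const_prog n)" for n
    by (induction n) auto
  ultimately show ?thesis by (metis (no_types, lifting) cf_cong)
qed

text \<open>Composition with \<open>Z\<close> normalizes the output, so that halting is the same as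
  the output 0, a question about a single value.\<close>

lemma evalo_search:
  fixes R :: "'a::ecode \<Rightarrow> nat \<Rightarrow> bool"
  assumes "cf Ora (\<lambda>t. R (fst t) (snd t))"
  shows "\<exists>q. (\<forall>x. (\<exists>v. evalo Ora q [ec x] v) \<longleftrightarrow> (\<exists>y. R x y)) \<and> (\<forall>n v. evalo Ora q [n] v \<longrightarrow> v = 0)"
proof -
  have "cf Ora (\<lambda>t. \<not> R (fst t) (snd t))" by (intro cf_intros assms)
  then obtain p where p: "\<And>x y. evalo Ora p [prod_encode (ec x, y)] (ec (\<not> R x y))"
    unfolding cf_def ec_prod_def ec_nat_def by fastforce
  let ?p = "Comp p [pair_prog (Proj 1) (Proj 0)]"
  let ?q = "Comp Z [Mn ?p]"
  have p': "evalo Ora ?p [y, ec x] (if R x y then 0 else 1)" for x y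
  proof -
    have "evalo Ora ?p [y, ec x] (ec (\<not> R x y))"
      by (intro evalo_Comp1[OF _ p] evalo_pair)
        (use evalo_Proj[of 0 "[y, ec x]"] evalo_Proj[of 1 "[y, ec x]"] in auto)
    then show ?thesis by (simp add: ec_bool_def split: if_splits)
  qed
  show ?thesis
  proof (intro exI[of _ ?q] conjI allI impI)
    show "v = 0" if "evalo Ora ?q [n] v" for n v
    proof -
      from that obtain ys where "evalo Ora Z ys v" by (elim evalo_CompE)
      then show ?thesis by (cases rule: evalo.cases) auto
    qed
    fix x :: 'a
    show "(\<exists>v. evalo Ora ?q [ec x] v) \<longleftrightarrow> (\<exists>y. R x y)"
    proof
      assume "\<exists>v. evalo Ora ?q [ec x] v"
      then obtain v where "evalo Ora (Mn ?p) [ec x] v"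
        by (auto elim!: evalo_CompE simp: list_all2_Cons1)
      then have "evalo Ora ?p [v, ec x] 0" by (cases rule: evalo.cases) auto
      from evalo_det[OF this p'] show "\<exists>y. R x y" by (auto split: if_splits)
    next
      assume "\<exists>y. R x y"
      from evalo_Comp1[OF evalo_Mn_Least[OF p' this] ev_Z] show "\<exists>v. evalo Ora ?q [ec x] v" ..
    qed
  qed
qed

text \<open>The input is built into a program that ignores its argument, so self-application halts
  iff the search does. The tag 4 belongs to \<open>Comp\<close>, and
  \<open>Suc (prod_encode (_, 0))\<close> codes a one-element list.\<close>

lemma halting_decides:
  fixes R :: "'a::ecode \<Rightarrow> nat \<Rightarrow> bool"
  assumes "cf {} (\<lambda>t. R (fst t) (snd t))"
  shows "cf halting_set (\<lambda>x. \<exists>y::nat. R x y)"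
proof -
  obtain q where q: "\<And>x. (\<exists>v. evalo {} q [ec x] v) \<longleftrightarrow> (\<exists>y. R x y)"
    using evalo_search[OF assms] by auto
  let ?P = "\<lambda>x::'a. Comp q [const_prog (ec x)]"
  have "cf halting_set (\<lambda>x::'a. prod_encode (4, prod_encode (encode q, Suc (prod_encode (encode (const_prog (ec x)), 0)))) \<in> halting_set)"
    by (intro cf_intros cf_compose[OF cf_encode_const])
  moreover have "prod_encode (4, prod_encode (encode q, Suc (prod_encode (encode (const_prog (ec x)), 0)))) \<in> halting_set
    \<longleftrightarrow> (\<exists>y. R x y)" for x :: 'a
  proof -
    have "prod_encode (4, prod_encode (encode q, Suc (prod_encode (encode (const_prog (ec x)), 0)))) = encode (?P x)"
      by simp
    moreover have "encode (?P x) \<in> halting_set \<longleftrightarrow> (\<exists>v. evalo {} (?P x) [encode (?P x)] v)"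
      unfolding halting_set_def by (auto simp del: encode.simps)
    moreover have "evalo {} (?P x) [encode (?P x)] v \<longleftrightarrow> evalo {} q [ec x] v" for v
      by (auto elim!: evalo_CompE simp: list_all2_Cons1 simp del: encode.simps
          intro: evalo_Comp1 evalo_const dest: evalo_det[OF evalo_const])
    ultimately show ?thesis using q by simp
  qed
  ultimately show ?thesis by simp
qed

lemma turing_reducible_cf: "A \<le>\<^sub>T B \<longleftrightarrow> cf B (\<lambda>n. n \<in> A)"
  by (simp add: turing_reducible_def cf_def chi_def ec_nat_def ec_bool_def)

subsection \<open>Strings and splittings\<close>

lemma cf_Collect [cf_intros]: "cf Ora (\<lambda>x. P x (f x)) \<Longrightarrow> cf Ora (\<lambda>x. f x \<in> {u. P x u})"
  by simp

lemma cf_Int [cf_intros]: "cf Ora (\<lambda>x. f x \<in> A x) \<Longrightarrow> cf Ora (\<lambda>x. f x \<in> B x) \<Longrightarrow> cf Ora (\<lambda>x. f x \<in> A x \<inter> B x)"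
  by (simp add: cf_conj)

lemma cf_Diff [cf_intros]: "cf Ora (\<lambda>x. f x \<in> A x) \<Longrightarrow> cf Ora (\<lambda>x. f x \<in> B x) \<Longrightarrow> cf Ora (\<lambda>x. f x \<in> A x - B x)"
  by (simp add: cf_conj cf_not)

definition str_of :: "nat \<Rightarrow> bool list" where
  "str_of n = map (\<lambda>i. i \<noteq> 0) (dc n :: nat list)"

lemma cf_str_of [cf_intros]: "cf Ora f \<Longrightarrow> cf Ora (\<lambda>x. str_of (f x))"
  unfolding str_of_def by (intro cf_intros)

lemma str_of_surj: "\<exists>n. str_of n = s"
proof
  have "(\<lambda>i. i \<noteq> 0) \<circ> (of_bool :: bool \<Rightarrow> nat) = id" by (rule ext) auto
  then show "str_of (ec (map of_bool s :: nat list)) = s" by (simp add: str_of_def)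
qed

primrec strs :: "nat \<Rightarrow> bool list list" where
  "strs 0 = [[]]"
| "strs (Suc m) = map ((#) True) (strs m) @ map ((#) False) (strs m)"

lemma set_strs [simp]: "set (strs m) = {s. length s = m}"
  by (induction m) (auto simp: length_Suc_conv image_def)

lemma cf_strs [cf_intros]:
  assumes "cf Ora f" shows "cf Ora (\<lambda>x. strs (f x))"
proof -
  have "cf Ora (\<lambda>x. rec_nat [[]] (\<lambda>n r. map (\<lambda>s. True # s) r @ map (\<lambda>s. False # s) r) (f x))"
    by (intro cf_intros assms)
  moreover have "rec_nat [[]] (\<lambda>n r. map (\<lambda>s. True # s) r @ map (\<lambda>s. False # s) r) n = strs n" for n
    by (induction n) auto
  ultimately show ?thesis by simp
qed

lemma prefix_mem_iff:
  "prefix s s' \<longleftrightarrow> length s \<le> length s' \<and> (\<forall>x<length s. mem s x \<longleftrightarrow> mem s' x)"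
proof
  assume "prefix s s'" then show "length s \<le> length s' \<and> (\<forall>x<length s. mem s x \<longleftrightarrow> mem s' x)"
    by (simp add: prefix_length_le mem_prefix)
next
  assume a: "length s \<le> length s' \<and> (\<forall>x<length s. mem s x \<longleftrightarrow> mem s' x)"
  then have "s = take (length s) s'" by (auto simp: list_eq_iff_nth_eq mem_def)
  then show "prefix s s'" by (metis take_is_prefix)
qed

lemma cf_prefix [cf_intros]:
  fixes s s' :: "'a::ecode \<Rightarrow> bool list"
  assumes "cf Ora s" "cf Ora s'" shows "cf Ora (\<lambda>x. prefix (s x) (s' x))"
proof (rule cf_comp2[where F = prefix, OF _ assms])
  show "cf Ora (\<lambda>t::bool list \<times> bool list. prefix (fst t) (snd t))"
    unfolding prefix_mem_iff by (intro cf_intros)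
qed

definition extn :: "bool list \<Rightarrow> nat set \<Rightarrow> bool list \<Rightarrow> bool" where
  "extn \<sigma> Y s \<longleftrightarrow> prefix \<sigma> s \<and> (\<forall>x<length s. length \<sigma> \<le> x \<longrightarrow> mem s x \<longrightarrow> x \<in> Y)"

lemma cf_extn [cf_intros]:
  assumes "cf Ora \<sigma>" "cf Ora (\<lambda>t. snd t \<in> Y (fst t))" "cf Ora s"
  shows "cf Ora (\<lambda>x. extn (\<sigma> x) (Y x) (s x))"
  unfolding extn_def
  by (intro cf_intros assms cf_compose[OF assms(1)] cf_compose[OF assms(3)])

text \<open>Padding by nonmembers postpones new elements: splittings over
  \<open>pad \<sigma> k\<close> use only new elements from \<open>k\<close> on.\<close>

definition pad :: "bool list \<Rightarrow> nat \<Rightarrow> bool list" where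
  "pad \<sigma> k = \<sigma> @ replicate (k - length \<sigma>) False"

lemma cf_pad [cf_intros]:
  assumes "cf Ora s" "cf Ora k" shows "cf Ora (\<lambda>x. pad (s x) (k x))"
proof -
  have "cf Ora (\<lambda>x. s x @ map (\<lambda>i. False) [0..<k x - length (s x)])" by (intro cf_intros assms)
  then show ?thesis by (simp add: pad_def map_replicate_const)
qed

lemma length_pad [simp]: "length (pad \<sigma> k) = max (length \<sigma>) k"
  by (simp add: pad_def)

lemma mem_pad [simp]: "mem (pad \<sigma> k) x \<longleftrightarrow> mem \<sigma> x"
  by (auto simp: mem_def pad_def nth_append)

lemma prefix_pad: "prefix \<sigma> (pad \<sigma> k)"
  by (simp add: pad_def)

lemma mem_length: "mem s x \<Longrightarrow> x < length s"
  by (simp add: mem_def)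

lemma extn_refl [simp]: "extn \<sigma> Y \<sigma>"
  by (simp add: extn_def)

lemma extn_pad: "extn \<sigma> Y (pad \<sigma> k)"
  by (auto simp: extn_def prefix_pad dest: mem_length)

lemma extn_trans: "extn \<sigma> Y s \<Longrightarrow> extn s Y u \<Longrightarrow> extn \<sigma> Y u"
  unfolding extn_def by (metis linorder_not_less mem_prefix mem_length prefix_order.order_trans)

lemma extn_mono: "extn \<sigma> Y s \<Longrightarrow> (\<And>x. x < length s \<Longrightarrow> length \<sigma> \<le> x \<Longrightarrow> x \<in> Y \<Longrightarrow> x \<in> Y') \<Longrightarrow> extn \<sigma> Y' s"
  by (auto simp: extn_def)

lemma extn_prefix: "extn \<sigma> Y s \<Longrightarrow> prefix \<sigma> s"
  by (simp add: extn_def)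

text \<open>Padding lets both strings have length \<open>m\<close>, and \<open>E\<close> already
  bounds inputs and values by that length. Only \<open>Y\<close> below \<open>m\<close> matters,
  which makes the relation decidable from \<open>Y\<close>.\<close>

definition Sp :: "bool list \<Rightarrow> nat \<Rightarrow> nat set \<Rightarrow> nat \<Rightarrow> bool" where
  "Sp \<sigma> e Y m \<longleftrightarrow> (\<exists>s\<in>set (strs m). \<exists>u\<in>set (strs m). extn \<sigma> Y s \<and> extn \<sigma> Y u \<and>
    (\<exists>n<m. \<exists>v<m. \<exists>w<m. E e s n v \<and> E e u n w \<and> v \<noteq> w))"

definition SP :: "bool list \<Rightarrow> nat \<Rightarrow> nat set \<Rightarrow> bool" where
  "SP \<sigma> e Y \<longleftrightarrow> (\<exists>m. Sp \<sigma> e Y m)"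

lemma cf_Sp [cf_intros]:
  assumes "cf Ora \<sigma>" "cf Ora e" "cf Ora (\<lambda>t. snd t \<in> Y (fst t))" "cf Ora m"
  shows "cf Ora (\<lambda>x. Sp (\<sigma> x) (e x) (Y x) (m x))"
proof -
  have Y: "cf Ora (\<lambda>x. f x \<in> Y (g x))" if "cf Ora f" "cf Ora g" for f and g :: "'z::ecode \<Rightarrow> _"
    using cf_compose[OF assms(3) cf_Pair[OF that(2,1)]] by simp
  show ?thesis
    unfolding Sp_def
    by (intro cf_intros Y cf_compose[OF assms(1)] cf_compose[OF assms(2)] cf_compose[OF assms(4)])
qed

lemma extend_strs:
  assumes "extn \<sigma> Y s" "m \<ge> length s"
  shows "pad s m \<in> set (strs m)" "extn \<sigma> Y (pad s m)" "E e s n v \<Longrightarrow> E e (pad s m) n v"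
  using assms extn_trans[OF assms(1) extn_pad] by (auto intro: E_mono prefix_pad)

lemma E_less: "E e s n v \<Longrightarrow> n < length s \<and> v < length s"
  by (simp add: E_def)

lemma SpI:
  assumes "extn \<sigma> Y s" "extn \<sigma> Y u" "E e s n v" "E e u n w" "v \<noteq> w" "length s \<le> m" "length u \<le> m"
  shows "Sp \<sigma> e Y m"
  unfolding Sp_def
  using extend_strs[OF assms(1,6)] extend_strs[OF assms(2,7)] assms(3-7) E_less[OF assms(3)] E_less[OF assms(4)]
  by (meson order_less_le_trans)

lemma SpE:
  assumes "Sp \<sigma> e Y m"
  obtains s u n v w where "length s = m" "length u = m" "extn \<sigma> Y s" "extn \<sigma> Y u" "E e s n v" "E e u n w" "v \<noteq> w"
  using assms unfolding Sp_def by auto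

lemma Sp_mono:
  assumes "Sp \<sigma> e Y m" "m \<le> m'" "\<And>x. x < m \<Longrightarrow> length \<sigma> \<le> x \<Longrightarrow> x \<in> Y \<Longrightarrow> x \<in> Y'"
  shows "Sp \<sigma> e Y' m'"
  using assms(1)
proof (rule SpE)
  fix s u n v w
  assume "length s = m" "length u = m" "extn \<sigma> Y s" "extn \<sigma> Y u" "E e s n v" "E e u n w" "v \<noteq> w"
  then show ?thesis using assms(2,3) by (intro SpI[of _ _ s u e n v w]) (auto elim: extn_mono)
qed

lemma SP_mono: "SP \<sigma> e Y \<Longrightarrow> (\<And>x. length \<sigma> \<le> x \<Longrightarrow> x \<in> Y \<Longrightarrow> x \<in> Y') \<Longrightarrow> SP \<sigma> e Y'"
  unfolding SP_def by (meson Sp_mono order_refl)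

lemma SP_I: "extn \<sigma> Y s \<Longrightarrow> extn \<sigma> Y u \<Longrightarrow> E e s n v \<Longrightarrow> E e u n w \<Longrightarrow> v \<noteq> w \<Longrightarrow> SP \<sigma> e Y"
  unfolding SP_def using SpI max.cobounded1 max.cobounded2 by blast

lemma SP_E:
  assumes "SP \<sigma> e Y"
  obtains s u n v w where "extn \<sigma> Y s" "extn \<sigma> Y u" "E e s n v" "E e u n w" "v \<noteq> w"
  using assms unfolding SP_def by (blast elim: SpE)

lemma SP_extn: "SP s e Y \<Longrightarrow> extn \<sigma> Y s \<Longrightarrow> SP \<sigma> e Y"
  by (erule SP_E) (blast intro: SP_I extn_trans)

text \<open>At the splitting input two different values occur, and at most one of them is the value
  of \<open>C\<close>.\<close>

lemma SP_diagonalize: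
  assumes "SP \<sigma> e Y"
  obtains s n v where "extn \<sigma> Y s" "E e s n v" "v \<noteq> chi C n"
  using assms by (elim SP_E) metis

text \<open>Without splittings, a computation from a set extending \<open>\<sigma>\<close> inside \<open>L\<close> can be replaced
  by any computation found by searching through the strings extending \<open>\<sigma>\<close> inside \<open>L\<close>.\<close>

lemma cf_of_no_split:
  assumes ns: "\<not> SP \<sigma> (encode f) L" and L: "cf G (\<lambda>x. x \<in> L)"
    and X: "\<And>m. length \<sigma> \<le> m \<Longrightarrow> extn \<sigma> L (res X m)" and f: "\<And>n. evalo X f [n] (chi C n)"
  shows "cf G (\<lambda>n. n \<in> C)"
proof -
  let ?e = "encode f"
  let ?P = "\<lambda>n m. \<exists>s\<in>set (strs m). extn \<sigma> L s \<and> (\<exists>v<m. E ?e s n v)"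
  have "\<exists>s. extn \<sigma> L s \<and> E ?e s n (chi C n)" for n
  proof -
    from f E_iff obtain m where "E ?e (res X m) n (chi C n)" by blast
    moreover have "prefix (res X m) (res X (max m (length \<sigma>)))" by (auto simp: prefix_mem_iff)
    ultimately show ?thesis using X[of "max m (length \<sigma>)"] E_mono by (metis max.cobounded2)
  qed
  then obtain s where s: "\<And>n. extn \<sigma> L (s n)" "\<And>n. E ?e (s n) n (chi C n)" by metis
  have val: "v = chi C n" if "extn \<sigma> L u" "E ?e u n v" for u n v
    using SP_I[OF that(1) s(1) that(2) s(2)] ns by blast
  have ex: "\<exists>m. ?P n m" for n
    using s E_less[OF s(2)] by (intro exI[of _ "length (s n)"] bexI[of _ "s n"]) auto
  have "n \<in> C \<longleftrightarrow> (\<exists>s\<in>set (strs (LEAST m. ?P n m)). extn \<sigma> L s \<and> E ?e s n 1)" (is "_ \<longleftrightarrow> ?R n") for n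
  proof -
    from LeastI_ex[OF ex[of n]] obtain u v where u: "length u = (LEAST m. ?P n m)" "extn \<sigma> L u" "E ?e u n v"
      by auto
    from val[OF u(2,3)] have v: "v = chi C n" .
    show ?thesis
    proof
      assume "n \<in> C"
      with u v show "?R n" by (intro bexI[of _ u]) (auto simp: chi_def)
    next
      assume "?R n"
      then have "1 = chi C n" using val by blast
      then show "n \<in> C" by (simp add: chi_def split: if_splits)
    qed
  qed
  moreover have "cf G ?R" by (intro cf_intros ex cf_compose[OF L])
  ultimately show ?thesis by (simp only:)
qed

subsection \<open>A low basis theorem with cone avoidance\<close>

lemma koenig:
  assumes pc: "\<And>s u. T u \<Longrightarrow> prefix s u \<Longrightarrow> T s" and inf: "\<And>m. \<exists>s. length s = m \<and> T s"
  shows "\<exists>X. \<forall>m. T (res X m)"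
proof -
  \<comment> \<open>The strings with extensions in \<open>T\<close> of every length; the path is
    built inside them.\<close>
  define I where "I s \<longleftrightarrow> (\<forall>m\<ge>length s. \<exists>u. length u = m \<and> prefix s u \<and> T u)" for s
  have step: "\<exists>b. I (s @ [b])" if "I s" for s
  proof (rule ccontr)
    assume "\<not> ?thesis"
    then obtain m where m: "\<And>b. length s < m b" "\<And>b u. length u = m b \<Longrightarrow> prefix (s @ [b]) u \<Longrightarrow> \<not> T u"
      unfolding I_def by (simp add: Suc_le_eq) metis
    \<comment> \<open>If both children die out, an extension of \<open>s\<close> of this length
      passes through one of them, and cutting it at the death length of that child gives a
      contradiction.\<close>
    let ?M = "max (m True) (m False)"
    from that m(1)[of True] obtain u where u: "length u = ?M" "prefix s u" "T u"
      unfolding I_def by (metis max.strict_coboundedI1 order_less_imp_le)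
    define b where "b = u ! length s"
    have "take (Suc (length s)) u = s @ [b]"
      using u m(1)[of True] by (auto simp: b_def take_Suc_conv_app_nth prefix_def)
    then have "prefix (s @ [b]) (take (m b) u)"
      using m(1)[of b] by (metis Suc_leI min_absorb1 take_is_prefix take_take)
    moreover have "length (take (m b) u) = m b" using u by (cases b) auto
    ultimately show False using m(2) pc[OF u(3) take_is_prefix] by blast
  qed
  obtain g where g: "\<And>s. I s \<Longrightarrow> I (s @ [g s])" using step by metis
  define h where "h = rec_nat [] (\<lambda>n s. s @ [g s])"
  have I: "I (h n)" for n
  proof (induction n)
    case 0 show ?case using inf by (simp add: h_def I_def)
  qed (auto simp: h_def intro: g)
  have len: "length (h n) = n" for n by (induction n) (auto simp: h_def)
  have "res {n. g (h n)} n = h n" for n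
    by (induction n) (auto simp: h_def res_def)
  moreover have "T (h n)" for n using I[of n] len unfolding I_def by (metis order_refl pc)
  ultimately show ?thesis by metis
qed

locale basis =
  fixes T :: "bool list \<Rightarrow> bool" and C :: "nat \<Rightarrow> nat set"
  assumes T_cf: "\<And>Ora. cf Ora T" and T_prefix: "\<And>s u. T u \<Longrightarrow> prefix s u \<Longrightarrow> T s"
    and T_inf: "\<And>m. \<exists>s. length s = m \<and> T s"
    and C_cf: "cf halting_set (\<lambda>t. snd t \<in> C (fst t))"
    and C_nc: "\<And>i. \<not> cf {} (\<lambda>n. n \<in> C i)"
begin

text \<open>A forcing condition is a finite list of computations \<open>(e, n, v)\<close> that the
  path must not perform. The strings obeying it form a subtree, whose infinitude \<open>Inf\<close>
  is decided by 0'.\<close>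

definition av :: "(nat \<times> nat \<times> nat) list \<Rightarrow> bool list \<Rightarrow> bool" where
  "av N s \<longleftrightarrow> T s \<and> (\<forall>c\<in>set N. \<not> E (fst c) s (fst (snd c)) (snd (snd c)))"

definition Inf :: "(nat \<times> nat \<times> nat) list \<Rightarrow> bool" where
  "Inf N \<longleftrightarrow> (\<forall>m. \<exists>s\<in>set (strs m). av N s)"

lemma cf_av: "cf Ora (\<lambda>t. av (fst t) (snd t))"
  unfolding av_def by (intro cf_intros cf_compose[OF T_cf])

lemma cf_Inf: "cf halting_set f \<Longrightarrow> cf halting_set (\<lambda>x. Inf (f x))"
proof (rule cf_compose[where g = Inf])
  have "cf halting_set (\<lambda>N. \<not> (\<exists>m. \<not> (\<exists>s\<in>set (strs m). av N s)))"
    by (intro cf_intros halting_decides cf_comp2[OF cf_av])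
  then show "cf halting_set Inf" unfolding Inf_def[abs_def] by simp
qed

lemma cf_chi: "cf halting_set i \<Longrightarrow> cf halting_set n \<Longrightarrow> cf halting_set (\<lambda>x. chi (C (i x)) (n x))"
  unfolding chi_def by (intro cf_intros cf_comp2[where F = "\<lambda>i n. n \<in> C i", OF C_cf])

text \<open>If no \<open>n\<close> satisfied this condition, then \<open>C i\<close> (with \<open>k\<close> coding \<open>(i, e)\<close>) would be computable:
  its value at \<open>n\<close> is the only one that every sufficiently long string of the tree is forced to output.\<close>

definition ok :: "nat \<Rightarrow> (nat \<times> nat \<times> nat) list \<Rightarrow> nat \<Rightarrow> bool" where
  "ok k N n \<longleftrightarrow> Inf ((snd (prod_decode k), n, chi (C (fst (prod_decode k))) n) # N) \<or>
    \<not> Inf ((snd (prod_decode k), n, 1 - chi (C (fst (prod_decode k))) n) # N)"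

definition avoid :: "nat \<Rightarrow> (nat \<times> nat \<times> nat) list \<Rightarrow> nat \<times> nat \<times> nat" where
  "avoid k N = (snd (prod_decode k), LEAST n. ok k N n, chi (C (fst (prod_decode k))) (LEAST n. ok k N n))"

text \<open>Decides the computation \<open>c\<close>: it is forbidden if possible, and otherwise
  every path obeying \<open>N\<close> performs it.\<close>

definition add :: "nat \<times> nat \<times> nat \<Rightarrow> (nat \<times> nat \<times> nat) list \<Rightarrow> (nat \<times> nat \<times> nat) list" where
  "add c N = (if Inf (c # N) then c # N else N)"

lemma ok_ex: "\<exists>n. ok k N n"
proof (rule ccontr)
  define e where "e = snd (prod_decode k)"
  define D where "D = C (fst (prod_decode k))"
  assume "\<not> ?thesis"
  then have no: "\<And>n. \<not> Inf ((e, n, chi D n) # N)" "\<And>n. Inf ((e, n, 1 - chi D n) # N)"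
    by (auto simp: ok_def e_def D_def)
  \<comment> \<open>At length \<open>m\<close> every string obeying \<open>N\<close> has already
    computed the value \<open>v\<close> at \<open>n\<close>.\<close>
  let ?Q = "\<lambda>n v m. \<forall>s\<in>set (strs m). \<not> av ((e, n, v) # N) s"
  have Q: "\<exists>m. ?Q n (chi D n) m" "\<not> ?Q n (1 - chi D n) m" for n m
    using no[of n] unfolding Inf_def by blast+
  have ex: "\<exists>m. \<exists>v<2. ?Q n v m" for n
  proof -
    have "chi D n < 2" by (simp add: chi_def)
    with Q(1)[of n] show ?thesis by blast
  qed
  have "n \<in> D \<longleftrightarrow> ?Q n 1 (LEAST m. \<exists>v<2. ?Q n v m)" (is "_ \<longleftrightarrow> ?R n") for n
  proof -
    define m where "m = (LEAST m. \<exists>v<2. ?Q n v m)"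
    from LeastI_ex[OF ex[of n]] obtain v where v: "v < 2" "?Q n v m" unfolding m_def by blast
    \<comment> \<open>The wrong value is never forced, because the condition forbidding it remains
      infinite.\<close>
    have "v \<noteq> 1 - chi D n"
    proof
      assume a: "v = 1 - chi D n"
      from Q(2)[of m n] v(2) show False unfolding a by blast
    qed
    then have vn: "v = chi D n" using v(1) by (auto simp: chi_def split: if_splits)
    have "?Q n 1 m \<longleftrightarrow> n \<in> D"
    proof (cases "n \<in> D")
      case True then show ?thesis using v(2) vn by (simp add: chi_def)
    next
      case False
      with Q(2)[of m n] have "\<not> ?Q n 1 m" by (simp add: chi_def)
      with False show ?thesis by blast
    qed
    then show ?thesis unfolding m_def by blast
  qed
  moreover have "cf {} ?R" by (intro cf_intros ex cf_comp2[OF cf_av])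
  ultimately have "cf {} (\<lambda>n. n \<in> D)" by (simp only:)
  then show False using C_nc by (simp add: D_def)
qed

lemma cf_ok: "cf halting_set k \<Longrightarrow> cf halting_set N \<Longrightarrow> cf halting_set n \<Longrightarrow> cf halting_set (\<lambda>x. ok (k x) (N x) (n x))"
  unfolding ok_def by (intro cf_intros cf_chi cf_Inf)

lemma cf_avoid: "cf halting_set (\<lambda>t. avoid (fst t) (snd t))"
  unfolding avoid_def by (intro cf_intros cf_chi cf_ok ok_ex)

lemma cf_add: "cf halting_set (\<lambda>t. add (fst t) (snd t))"
  unfolding add_def by (intro cf_intros cf_Inf)

text \<open>Stage \<open>k\<close> first treats the cone avoidance requirement \<open>k\<close> and
  then decides the jump question with code \<open>k\<close>.\<close>

primrec Seq :: "nat \<Rightarrow> (nat \<times> nat \<times> nat) list" where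
  "Seq 0 = []"
| "Seq (Suc k) = add (dc k) (add (avoid k (Seq k)) (Seq k))"

lemma cf_Seq: "cf halting_set Seq"
proof -
  have "cf halting_set (\<lambda>k. rec_nat [] (\<lambda>k N. add (dc k) (add (avoid k N) N)) k)"
    by (intro cf_intros cf_comp2[OF cf_add] cf_comp2[OF cf_avoid])
  moreover have "rec_nat [] (\<lambda>k N. add (dc k) (add (avoid k N) N)) k = Seq k" for k
    by (induction k) auto
  ultimately show ?thesis by simp
qed

lemma Inf_add: "Inf N \<Longrightarrow> Inf (add c N)"
  by (simp add: add_def)

lemma av_add: "av (add c N) s \<Longrightarrow> av N s"
  by (auto simp: add_def av_def split: if_splits)

lemma Inf_Seq: "Inf (Seq k)"
proof (induction k)
  case 0 show ?case using T_inf by (auto simp: Inf_def av_def)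
qed (auto intro: Inf_add)

lemma av_Seq_mono: "k \<le> k' \<Longrightarrow> av (Seq k') s \<Longrightarrow> av (Seq k) s"
  by (induction rule: dec_induct) (auto dest!: av_add)

text \<open>Each length has finitely many strings and conditions only grow, so if every string were
  excluded at some stage, all would be excluded at the largest of these stages, where the tree is
  infinite.\<close>

lemma generic_path: "\<exists>G. \<forall>m k. av (Seq k) (res G m)"
proof -
  have "\<exists>G. \<forall>m. \<forall>k. av (Seq k) (res G m)"
  proof (rule koenig[where T = "\<lambda>s. \<forall>k. av (Seq k) s"])
    fix s u assume "\<forall>k. av (Seq k) u" "prefix s u"
    then show "\<forall>k. av (Seq k) s" unfolding av_def using T_prefix E_mono by blast
  next
    fix m
    show "\<exists>s. length s = m \<and> (\<forall>k. av (Seq k) s)"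
    proof (rule ccontr)
      assume "\<not> ?thesis"
      then obtain k where k: "\<And>s. length s = m \<Longrightarrow> \<not> av (Seq (k s)) s" by metis
      define K where "K = Max (k ` set (strs m))"
      obtain s where s: "s \<in> set (strs m)" "av (Seq K) s" using Inf_Seq unfolding Inf_def by blast
      then have "k s \<le> K" unfolding K_def by (intro Max_ge finite_imageI finite_set imageI)
      then show False using av_Seq_mono[OF _ s(2)] k s(1) by auto
    qed
  qed
  then show ?thesis .
qed

text \<open>If \<open>c\<close> could not be forbidden, the subtree ends at some length; the segment
  of \<open>G\<close> of that length obeys \<open>N\<close>, so it must perform
  \<open>c\<close>.\<close>

lemma generic_add:
  assumes G: "\<And>m. av (add c N) (res G m)"
  shows "(\<exists>m. E (fst c) (res G m) (fst (snd c)) (snd (snd c))) \<longleftrightarrow> \<not> Inf (c # N)"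
proof
  assume "\<exists>m. E (fst c) (res G m) (fst (snd c)) (snd (snd c))"
  then show "\<not> Inf (c # N)" using G by (auto simp: add_def av_def split: if_splits)
next
  assume "\<not> Inf (c # N)"
  then obtain m where m: "\<forall>s\<in>set (strs m). \<not> av (c # N) s" unfolding Inf_def by blast
  then have "\<not> av (c # N) (res G m)" by simp
  moreover have "av N (res G m)" using G by (rule av_add)
  ultimately show "\<exists>m. E (fst c) (res G m) (fst (snd c)) (snd (snd c))"
    by (auto simp: av_def)
qed

theorem low_cone_avoiding:
  "\<exists>G. (\<forall>m. T (res G m)) \<and> cf halting_set (\<lambda>c. \<exists>m. E (fst c) (res G m) (fst (snd c)) (snd (snd c))) \<and>
    (\<forall>i. \<not> cf G (\<lambda>n. n \<in> C i))"
proof -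
  obtain G where G: "\<And>m k. av (Seq k) (res G m)" using generic_path by blast
  have Gs: "av (add (dc k) (add (avoid k (Seq k)) (Seq k))) (res G m)" for k m
    using G[of "Suc k" m] by simp
  have "(\<exists>m. E (fst c) (res G m) (fst (snd c)) (snd (snd c))) \<longleftrightarrow>
      \<not> Inf (c # add (avoid (ec c) (Seq (ec c))) (Seq (ec c)))" for c
    by (rule generic_add) (use Gs[of "ec c"] in simp)
  moreover have "cf halting_set (\<lambda>c. \<not> Inf (c # add (avoid (ec c) (Seq (ec c))) (Seq (ec c))))"
    by (intro cf_intros cf_Inf cf_comp2[OF cf_add] cf_comp2[OF cf_avoid] cf_compose[OF cf_Seq])
  ultimately have low: "cf halting_set (\<lambda>c. \<exists>m. E (fst c) (res G m) (fst (snd c)) (snd (snd c)))"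
    by (simp only:)
  have "\<not> cf G (\<lambda>n. n \<in> C i)" for i
  proof
    assume "cf G (\<lambda>n. n \<in> C i)"
    then obtain p where p: "\<And>n. evalo G p [n] (chi (C i) n)"
      by (auto simp: turing_reducible_cf[symmetric] turing_reducible_def)
    define k where "k = prod_encode (i, encode p)"
    define n where "n = (LEAST n. ok k (Seq k) n)"
    have a: "avoid k (Seq k) = (encode p, n, chi (C i) n)" by (simp add: avoid_def k_def n_def)
    have "(\<exists>m. E (encode p) (res G m) n (chi (C i) n)) \<longleftrightarrow> \<not> Inf ((encode p, n, chi (C i) n) # Seq k)"
      using generic_add[of "avoid k (Seq k)" "Seq k" G] Gs[of k, THEN av_add] a by simp
    then have "\<not> Inf ((encode p, n, chi (C i) n) # Seq k)" using p E_iff by blast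
    \<comment> \<open>The true value could not be forbidden, so by \<open>ok\<close> neither could
      the wrong one; then \<open>G\<close> would compute both.\<close>
    moreover have "ok k (Seq k) n" unfolding n_def by (rule LeastI_ex[OF ok_ex])
    ultimately have "\<not> Inf ((encode p, n, 1 - chi (C i) n) # Seq k)" by (simp add: ok_def k_def)
    then obtain m where "\<forall>s\<in>set (strs m). \<not> av ((encode p, n, 1 - chi (C i) n) # Seq k) s"
      unfolding Inf_def by blast
    then have "\<not> av ((encode p, n, 1 - chi (C i) n) # Seq k) (res G m)" by simp
    moreover have "av (Seq k) (res G m)" by (rule G)
    ultimately have "E (encode p) (res G m) n (1 - chi (C i) n)"
      by (auto simp: av_def)
    then have "evalo G p [n] (1 - chi (C i) n)" using E_iff by blast
    from evalo_det[OF this p] show False by (auto simp: chi_def split: if_splits)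
  qed
  moreover have "T (res G m)" for m using G[of 0 m] by (simp add: av_def)
  ultimately show ?thesis using low by blast
qed

end

text \<open>Lowness at work: a search relative to \<open>G\<close> is a program whose only possible
  output is 0, hence a single jump question.\<close>

lemma low_decides:
  fixes R :: "'a::ecode \<Rightarrow> nat \<Rightarrow> bool"
  assumes low: "cf halting_set (\<lambda>c. \<exists>m. E (fst c) (res G m) (fst (snd c)) (snd (snd c)))"
    and R: "cf G (\<lambda>t. R (fst t) (snd t))"
  shows "cf halting_set (\<lambda>x. \<exists>y. R x y)"
proof -
  obtain q where q: "\<And>x. (\<exists>v. evalo G q [ec x] v) \<longleftrightarrow> (\<exists>y. R x y)" "\<And>n v. evalo G q [n] v \<Longrightarrow> v = 0"
    using evalo_search[OF R] by auto
  have "cf halting_set (\<lambda>x::'a. (encode q, ec x, 0 :: nat))" by (intro cf_intros)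
  from cf_compose[OF low this] have "cf halting_set (\<lambda>x::'a. \<exists>m. E (encode q) (res G m) (ec x) 0)" by simp
  moreover have "(\<exists>m. E (encode q) (res G m) (ec x) 0) \<longleftrightarrow> (\<exists>y. R x y)" for x
    unfolding E_iff using q by metis
  ultimately show ?thesis by simp
qed

subsection \<open>A low family of sets closed under choosing splitting-free subsets\<close>

type_synonym par = "nat \<times> nat \<times> nat \<times> nat \<times> nat"

text \<open>A parameter \<open>(p, a, e, b, e')\<close> stands for the parent set \<open>L p\<close> and the pairs \<open>(\<sigma>, e)\<close>, \<open>(\<tau>, e')\<close> with
  \<open>\<sigma> = str_of a\<close> and \<open>\<tau> = str_of b\<close>: the chosen subset has no splitting over \<open>(\<tau>, e')\<close> and its complement
  in \<open>L p\<close> has none over \<open>(\<sigma>, e)\<close>. This is a \<open>\<Pi>\<^sup>0\<^sub>1\<close> condition relative to \<open>L p\<close>.\<close>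

definition Q :: "par \<Rightarrow> nat set \<Rightarrow> nat set \<Rightarrow> bool" where
  "Q c L Y \<longleftrightarrow> Y \<subseteq> L \<and> \<not> SP (str_of (fst (snd (snd (snd c))))) (snd (snd (snd (snd c)))) Y \<and>
    \<not> SP (str_of (fst (snd c))) (fst (snd (snd c))) (L - Y)"

definition Qm :: "par \<Rightarrow> nat set \<Rightarrow> nat set \<Rightarrow> nat \<Rightarrow> bool" where
  "Qm c L Y m \<longleftrightarrow> (\<forall>x<m. x \<in> Y \<longrightarrow> x \<in> L) \<and>
    \<not> Sp (str_of (fst (snd (snd (snd c))))) (snd (snd (snd (snd c)))) Y m \<and>
    \<not> Sp (str_of (fst (snd c))) (fst (snd (snd c))) (L - Y) m"

lemma Q_iff: "Q c L Y \<longleftrightarrow> (\<forall>m. Qm c L Y m)"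
  unfolding Q_def Qm_def SP_def by (auto simp: subset_eq)

lemma cf_Qm [cf_intros]:
  assumes "cf Ora c" "cf Ora (\<lambda>t. snd t \<in> L (fst t))" "cf Ora (\<lambda>t. snd t \<in> Y (fst t))" "cf Ora m"
  shows "cf Ora (\<lambda>x. Qm (c x) (L x) (Y x) (m x))"
  unfolding Qm_def
  by (intro cf_intros assms cf_compose[OF assms(1)] cf_compose[OF assms(4)])

lemma Qm_mono: "Qm c L Y m \<Longrightarrow> k \<le> m \<Longrightarrow> Qm c L Y k"
  unfolding Qm_def by (meson Sp_mono order_less_le_trans)

lemma Qm_cong:
  assumes "\<And>x. x < m \<Longrightarrow> x \<in> L \<longleftrightarrow> x \<in> L'" "\<And>x. x < m \<Longrightarrow> x \<in> Y \<longleftrightarrow> x \<in> Y'"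
  shows "Qm c L Y m \<longleftrightarrow> Qm c L' Y' m"
proof -
  have "Sp s e Y m \<longleftrightarrow> Sp s e Y' m" "Sp s e (L - Y) m \<longleftrightarrow> Sp s e (L' - Y') m" for s e
    by (auto intro: Sp_mono simp: assms)
  then show ?thesis by (simp add: Qm_def assms)
qed

text \<open>If admissible strings exist at all lengths, compactness gives a full member. Otherwise
  the lengths with one form an initial segment, and a string of the greatest such length serves for
  all of them. A column can thus be filled even when the class is empty.\<close>

lemma Qm_choice: "\<exists>Y. \<forall>m. (\<exists>y\<in>set (strs m). Qm c L {x. mem y x} m) \<longrightarrow> Qm c L Y m"
proof -
  let ?P = "\<lambda>m. \<exists>y\<in>set (strs m). Qm c L {x. mem y x} m"
  have restrict: "Qm c L {x. mem s x} (length s)" if "Qm c L {x. mem u x} m" "prefix s u" "length s \<le> m" for s u m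
    using Qm_mono[OF that(1,3)] Qm_cong[of "length s" L L "{x. mem s x}" "{x. mem u x}" c] mem_prefix[OF that(2)] by simp
  show ?thesis
  proof (cases "\<forall>m. ?P m")
    case True
    have "\<exists>X. \<forall>m. Qm c L {x. mem (res X m) x} (length (res X m))"
    proof (rule koenig)
      fix s u assume "Qm c L {x. mem u x} (length u)" "prefix s u"
      then show "Qm c L {x. mem s x} (length s)" by (intro restrict) (auto simp: prefix_length_le)
    qed (use True in auto)
    then obtain X where X: "\<And>m. Qm c L {x. mem (res X m) x} m" by auto
    have "Qm c L X m" for m
      using X[of m] Qm_cong[of m L L X "{x. mem (res X m) x}" c] by simp
    then show ?thesis by blast
  next
    case False
    define m0 where "m0 = (LEAST m. \<not> ?P m)"
    from False have ex: "\<exists>m. \<not> ?P m" by blast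
    have m0: "\<not> ?P m0" unfolding m0_def by (rule LeastI_ex[OF ex])
    have below: "?P m" if "m < m0" for m using not_less_Least[OF that[unfolded m0_def]] by blast
    have lt: "m < m0" if "?P m" for m
    proof (rule ccontr)
      assume "\<not> m < m0"
      then have "m0 \<le> m" by simp
      from that obtain y where "length y = m" "Qm c L {x. mem y x} m" by auto
      then have "Qm c L {x. mem (take m0 y) x} m0"
        using restrict[of y m "take m0 y"] \<open>m0 \<le> m\<close> by (simp add: take_is_prefix min_absorb2)
      moreover have "take m0 y \<in> set (strs m0)" using \<open>m0 \<le> m\<close> \<open>length y = m\<close> by simp
      ultimately show False using m0 by blast
    qed
    show ?thesis
    proof (cases m0)
      case 0 then show ?thesis using lt by blast
    next
      case (Suc k)
      then obtain y where "Qm c L {x. mem y x} k" using below[of k] by auto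
      then have "\<forall>m. ?P m \<longrightarrow> Qm c L {x. mem y x} m" using lt Suc Qm_mono by (metis less_Suc_eq_le)
      then show ?thesis by blast
    qed
  qed
qed

lemma fst_dc_le: "fst (dc c :: par) \<le> c"
proof -
  have "c = ec (dc c :: par)" by simp
  also have "\<dots> = prod_encode (fst (dc c :: par), ec (snd (dc c :: par)))" by (simp add: ec_prod_def ec_nat_def)
  finally show ?thesis using le_prod_encode_1 by metis
qed

text \<open>A noncomputable choice that only shows the tree below to be infinite. The recursion
  terminates because the parent index is at most \<open>c\<close>.\<close>

function family :: "nat \<Rightarrow> nat set" where
  "family 0 = UNIV"
| "family (Suc c) = (SOME Y. \<forall>m. (\<exists>y\<in>set (strs m). Qm (dc c) (family (fst (dc c :: par))) {x. mem y x} m) \<longrightarrow>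
    Qm (dc c) (family (fst (dc c :: par))) Y m)"
  by pat_completeness auto
termination by (relation "measure id") (auto simp: fst_dc_le less_Suc_eq_le)

definition colm :: "bool list \<Rightarrow> nat \<Rightarrow> nat set" where
  "colm g p = {x. mem g (prod_encode (p, x))}"

text \<open>A clause applies only when all bits of both columns below \<open>m\<close> are already
  recorded in \<open>g\<close>, so every clause is decidable and initial segments of members are
  members.\<close>

definition tree :: "bool list \<Rightarrow> bool" where
  "tree g \<longleftrightarrow> (\<forall>x<length g. prod_encode (0, x) < length g \<longrightarrow> mem g (prod_encode (0, x))) \<and>
    (\<forall>c<length g. \<forall>m<length g.
      (\<forall>x<m. prod_encode (Suc c, x) < length g \<and> prod_encode (fst (dc c :: par), x) < length g) \<longrightarrow>
      (\<exists>y\<in>set (strs m). Qm (dc c) (colm g (fst (dc c :: par))) {x. mem y x} m) \<longrightarrow>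
      Qm (dc c) (colm g (fst (dc c :: par))) (colm g (Suc c)) m)"

lemma cf_tree: "cf Ora tree"
  unfolding tree_def[abs_def] colm_def by (intro cf_intros)

lemma tree_prefix:
  assumes "tree u" "prefix s u" shows "tree s"
proof -
  have len: "length s \<le> length u" and mem: "\<And>x. x < length s \<Longrightarrow> mem u x \<longleftrightarrow> mem s x"
    using assms(2) by (auto simp: prefix_length_le mem_prefix)
  show ?thesis
    unfolding tree_def
  proof (intro conjI allI impI)
    fix x assume "x < length s" "prod_encode (0, x) < length s"
    then show "mem s (prod_encode (0, x))" using assms(1) len mem unfolding tree_def
      by (meson order_less_le_trans)
  next
    fix c m
    let ?p = "fst (dc c :: par)"
    assume c: "c < length s" "m < length s" and x: "\<forall>x<m. prod_encode (Suc c, x) < length s \<and> prod_encode (?p, x) < length s"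
      and y: "\<exists>y\<in>set (strs m). Qm (dc c) (colm s ?p) {x. mem y x} m"
    have eq: "Qm (dc c) (colm u ?p) Y m \<longleftrightarrow> Qm (dc c) (colm s ?p) Y m" for Y
      by (rule Qm_cong) (use x mem in \<open>auto simp: colm_def\<close>)
    have eq': "Qm (dc c) (colm u ?p) (colm u (Suc c)) m \<longleftrightarrow> Qm (dc c) (colm s ?p) (colm s (Suc c)) m"
      by (rule Qm_cong) (use x mem in \<open>auto simp: colm_def\<close>)
    have "c < length u" "m < length u" "\<forall>x<m. prod_encode (Suc c, x) < length u \<and> prod_encode (?p, x) < length u"
      using c x len by (auto intro: order_less_le_trans)
    moreover have "\<exists>y\<in>set (strs m). Qm (dc c) (colm u ?p) {x. mem y x} m"
      using y unfolding eq .
    ultimately have "Qm (dc c) (colm u ?p) (colm u (Suc c)) m"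
      using assms(1) unfolding tree_def by blast
    then show "Qm (dc c) (colm s ?p) (colm s (Suc c)) m" unfolding eq' .
  qed
qed

lemma colm_res: "x \<in> colm (res G m) p \<longleftrightarrow> prod_encode (p, x) < m \<and> prod_encode (p, x) \<in> G"
  by (simp add: colm_def)

text \<open>The join of all sets of \<open>family\<close> is a path.\<close>

lemma tree_infinite: "\<exists>s. length s = n \<and> tree s"
proof -
  define G where "G = {prod_encode (p, x) | p x. x \<in> family p}"
  have G: "prod_encode (p, x) \<in> G \<longleftrightarrow> x \<in> family p" for p x by (auto simp: G_def)
  have fam: "(\<exists>y\<in>set (strs m). Qm (dc c) (family (fst (dc c :: par))) {x. mem y x} m) \<Longrightarrow>
      Qm (dc c) (family (fst (dc c :: par))) (family (Suc c)) m" for c m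
    using someI_ex[OF Qm_choice[of "dc c" "family (fst (dc c :: par))"]] by simp
  have "tree (res G n)"
    unfolding tree_def
  proof (intro conjI allI impI)
    fix x assume "prod_encode (0, x) < length (res G n)"
    then show "mem (res G n) (prod_encode (0, x))" by (simp add: G)
  next
    fix c m
    let ?p = "fst (dc c :: par)"
    assume x: "\<forall>x<m. prod_encode (Suc c, x) < length (res G n) \<and> prod_encode (?p, x) < length (res G n)"
      and y: "\<exists>y\<in>set (strs m). Qm (dc c) (colm (res G n) ?p) {x. mem y x} m"
    have eq: "Qm (dc c) (colm (res G n) ?p) Y m \<longleftrightarrow> Qm (dc c) (family ?p) Y m" for Y
      by (rule Qm_cong) (use x in \<open>auto simp: colm_res G\<close>)
    have eq': "Qm (dc c) (colm (res G n) ?p) (colm (res G n) (Suc c)) m \<longleftrightarrow> Qm (dc c) (family ?p) (family (Suc c)) m"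
      by (rule Qm_cong) (use x in \<open>auto simp: colm_res G simp del: family.simps\<close>)
    show "Qm (dc c) (colm (res G n) ?p) (colm (res G n) (Suc c)) m"
      unfolding eq' by (rule fam) (use y in \<open>simp only: eq\<close>)
  qed
  then show ?thesis by (intro exI[of _ "res G n"]) simp
qed

lemma tree_path:
  assumes G: "\<And>m. tree (res G m)"
  defines "L \<equiv> \<lambda>p. {x. prod_encode (p, x) \<in> G}"
  shows "L 0 = UNIV" "Q (dc c) (L (fst (dc c :: par))) Y \<Longrightarrow> Q (dc c) (L (fst (dc c :: par))) (L (Suc c))"
proof -
  have "x \<in> L 0" for x
  proof -
    have "x < Suc (prod_encode (0, x))" using le_prod_encode_2 by (simp add: less_Suc_eq_le)
    then have "mem (res G (Suc (prod_encode (0, x)))) (prod_encode (0, x))"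
      using G[of "Suc (prod_encode (0, x))"] unfolding tree_def by simp
    then show ?thesis by (simp add: L_def)
  qed
  then show "L 0 = UNIV" by blast
next
  let ?p = "fst (dc c :: par)"
  assume Y: "Q (dc c) (L ?p) Y"
  show "Q (dc c) (L ?p) (L (Suc c))"
    unfolding Q_iff
  proof
    fix m
    obtain M where M: "\<forall>x<m. prod_encode (Suc c, x) < M \<and> prod_encode (?p, x) < M" "c < M" "m < M"
    proof
      let ?M = "Suc (c + m + (\<Sum>x<m. prod_encode (Suc c, x) + prod_encode (?p, x)))"
      have "prod_encode (Suc c, x) + prod_encode (?p, x) \<le> (\<Sum>x<m. prod_encode (Suc c, x) + prod_encode (?p, x))"
        if "x < m" for x by (rule member_le_sum[of x]) (use that in auto)
      then show "\<forall>x<m. prod_encode (Suc c, x) < ?M \<and> prod_encode (?p, x) < ?M" by fastforce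
    qed auto
    have eq: "Qm (dc c) (colm (res G M) ?p) Y m \<longleftrightarrow> Qm (dc c) (L ?p) Y m" for Y
      by (rule Qm_cong) (use M in \<open>auto simp: colm_res L_def\<close>)
    have eq': "Qm (dc c) (colm (res G M) ?p) (colm (res G M) (Suc c)) m \<longleftrightarrow> Qm (dc c) (L ?p) (L (Suc c)) m"
      by (rule Qm_cong) (use M in \<open>auto simp: colm_res L_def\<close>)
    \<comment> \<open>The initial segment of a member \<open>Y\<close> is the string that activates
      the clause of the tree at length \<open>m\<close>.\<close>
    have "Qm (dc c) (L ?p) {x. mem (res Y m) x} m \<longleftrightarrow> Qm (dc c) (L ?p) Y m" by (rule Qm_cong) auto
    then have "Qm (dc c) (L ?p) {x. mem (res Y m) x} m" using Y unfolding Q_iff by blast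
    then have "\<exists>y\<in>set (strs m). Qm (dc c) (colm (res G M) ?p) {x. mem y x} m"
      unfolding eq by (rule bexI) simp
    then have "Qm (dc c) (colm (res G M) ?p) (colm (res G M) (Suc c)) m"
      using G[of M] M unfolding tree_def length_res by blast
    then show "Qm (dc c) (L ?p) (L (Suc c)) m" unfolding eq' .
  qed
qed

subsection \<open>The two constructions\<close>

locale reservoir =
  fixes C :: "nat \<Rightarrow> nat set" and G :: "nat set" and L :: "nat \<Rightarrow> nat set"
  assumes C_cf: "cf halting_set (\<lambda>t. snd t \<in> C (fst t))"
    and low: "cf halting_set (\<lambda>c. \<exists>m. E (fst c) (res G m) (fst (snd c)) (snd (snd c)))"
    and avoids: "\<And>i. \<not> cf G (\<lambda>n. n \<in> C i)"
    and L_cf: "cf G (\<lambda>t. snd t \<in> L (fst t))"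
    and L_0: "L 0 = UNIV"
    and L_Suc: "\<And>c Y. Q (dc c) (L (fst (dc c :: par))) Y \<Longrightarrow> Q (dc c) (L (fst (dc c :: par))) (L (Suc c))"
begin

lemma cf_L:
  fixes f p :: "'a::ecode \<Rightarrow> nat"
  assumes "cf halting_set p" "cf halting_set f" shows "cf halting_set (\<lambda>x. f x \<in> L (p x))"
proof (rule cf_comp2[where F = "\<lambda>p x. x \<in> L p", OF _ assms])
  \<comment> \<open>The vacuous quantifier turns membership into a search, so that lowness
    applies.\<close>
  have "cf halting_set (\<lambda>t. \<exists>y::nat. snd t \<in> L (fst t))"
    by (rule low_decides[OF low]) (intro cf_compose[OF L_cf] cf_intros)
  then show "cf halting_set (\<lambda>t. snd t \<in> L (fst t))" by simp
qed

lemma cf_L': "cf G (\<lambda>x. x \<in> L p)"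
  using cf_compose[OF L_cf cf_Pair[OF cf_const cf_id]] by simp

lemma cf_SP:
  assumes "cf halting_set s" "cf halting_set e" "cf halting_set p"
  shows "cf halting_set (\<lambda>x. SP (s x) (e x) (L (p x)))"
proof (rule cf_comp3[where F = "\<lambda>s e p. SP s e (L p)", OF _ assms])
  have L: "cf G (\<lambda>x. f x \<in> L (p x))" if "cf G p" "cf G f" for p and f :: "'z::ecode \<Rightarrow> nat"
    by (rule cf_comp2[where F = "\<lambda>p x. x \<in> L p", OF L_cf that])
  show "cf halting_set (\<lambda>t. SP (fst t) (fst (snd t)) (L (snd (snd t))))"
    unfolding SP_def by (rule low_decides[OF low]) (intro cf_intros L)
qed

definition inQ :: "nat \<Rightarrow> bool" where
  "inQ c \<longleftrightarrow> Q (dc c) (L (fst (dc c :: par))) (L (Suc c))"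

lemma cf_inQ: "cf halting_set f \<Longrightarrow> cf halting_set (\<lambda>x. inQ (f x))"
proof (rule cf_compose[where g = inQ])
  have L: "cf G (\<lambda>x. f x \<in> L (p x))" if "cf G p" "cf G f" for p and f :: "'z::ecode \<Rightarrow> nat"
    by (rule cf_comp2[where F = "\<lambda>p x. x \<in> L p", OF L_cf that])
  have "cf halting_set (\<lambda>c. \<not> (\<exists>m. \<not> Qm (dc c) (L (fst (dc c :: par))) (L (Suc c)) m))"
    by (rule cf_not, rule low_decides[OF low]) (intro cf_intros L)
  then show "cf halting_set inQ" by (simp add: inQ_def[abs_def] Q_iff)
qed

lemma cf_chi_C: "cf halting_set i \<Longrightarrow> cf halting_set n \<Longrightarrow> cf halting_set (\<lambda>x. chi (C (i x)) (n x))"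
  unfolding chi_def by (intro cf_intros cf_comp2[where F = "\<lambda>i n. n \<in> C i", OF C_cf])

text \<open>A set computable from \<open>G\<close> inherits its cone avoidance; transitivity is
  carried out by searching for computations on initial segments of \<open>V\<close>.\<close>

lemma computable_reservoir:
  assumes "V \<subseteq> D" "infinite V" "cf G (\<lambda>x. x \<in> V)"
  shows "\<exists>X. X \<subseteq> D \<and> infinite X \<and> Delta02 X \<and> (\<forall>i. \<not> C i \<le>\<^sub>T X)"
proof (intro exI[of _ V] conjI allI)
  have "cf halting_set (\<lambda>x. \<exists>y::nat. x \<in> V)"
    by (rule low_decides[OF low]) (intro cf_compose[OF assms(3)] cf_intros)
  then show "Delta02 V" by (simp add: Delta02_def turing_reducible_cf)
  show "\<not> C i \<le>\<^sub>T V" for i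
  proof
    assume "C i \<le>\<^sub>T V"
    then obtain f where f: "\<And>n. evalo V f [n] (chi (C i) n)" unfolding turing_reducible_def by blast
    let ?P = "\<lambda>n m. \<exists>v<m. E (encode f) (res V m) n v"
    have ex: "\<exists>m. ?P n m" for n
      using f[of n] E_less unfolding E_iff[symmetric] by (metis length_res)
    have val: "v = chi (C i) n" if "E (encode f) (res V m) n v" for m n v
      using evalo_det[OF _ f] E_iff that by blast
    have "n \<in> C i \<longleftrightarrow> E (encode f) (res V (LEAST m. ?P n m)) n 1" (is "_ \<longleftrightarrow> ?R n") for n
    proof -
      from LeastI_ex[OF ex[of n]] obtain v where v: "E (encode f) (res V (LEAST m. ?P n m)) n v" by blast
      show ?thesis
      proof
        assume "n \<in> C i"
        with v val[OF v] show "?R n" by (simp add: chi_def)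
      next
        assume "?R n"
        from val[OF this] show "n \<in> C i" by (simp add: chi_def split: if_splits)
      qed
    qed
    moreover have "cf G ?R" by (intro cf_intros ex cf_compose[OF assms(3)])
    ultimately have "cf G (\<lambda>n. n \<in> C i)" by (simp only:)
    then show False using avoids by blast
  qed
qed (use assms in auto)

lemma cofinite_reservoir:
  assumes "infinite (L p)" "finite (L p - D)"
  shows "\<exists>X. X \<subseteq> D \<and> infinite X \<and> Delta02 X \<and> (\<forall>i. \<not> C i \<le>\<^sub>T X)"
proof -
  from assms(2) obtain k where k: "\<forall>x\<in>L p - D. x < k" using finite_nat_set_iff_bounded by blast
  have inf: "infinite {x. x \<in> L p \<and> k \<le> x}"
    using assms(1) unfolding infinite_nat_iff_unbounded_le
    by (metis (mono_tags, lifting) max.bounded_iff mem_Collect_eq)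
  show ?thesis
  proof (rule computable_reservoir[OF _ inf])
    show "{x. x \<in> L p \<and> k \<le> x} \<subseteq> D" using k by (auto simp: not_less[symmetric])
    show "cf G (\<lambda>x. x \<in> {x. x \<in> L p \<and> k \<le> x})"
      by (intro cf_intros cf_L')
  qed
qed

text \<open>Common last part of both constructions. Each requirement is met by a wrong value already
  computed, or by staying inside a splitting-free \<open>L p\<close>, which would make
  \<open>C i\<close> computable from \<open>G\<close>.\<close>

lemma limit_set:
  assumes tau: "cf halting_set tau" and chain: "\<And>t. prefix (tau t) (tau (Suc t))"
    and D: "\<And>t x. mem (tau t) x \<Longrightarrow> x \<in> D"
    and unb: "\<And>k. \<exists>t x. k \<le> x \<and> mem (tau t) x"
    and req: "\<And>i e. \<exists>t. (\<exists>n v. E e (tau t) n v \<and> v \<noteq> chi (C i) n) \<or>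
      (\<exists>p. \<not> SP (tau t) e (L p) \<and> (\<forall>t'\<ge>t. extn (tau t) (L p) (tau t')))"
  shows "\<exists>X. X \<subseteq> D \<and> infinite X \<and> Delta02 X \<and> (\<forall>i. \<not> C i \<le>\<^sub>T X)"
proof -
  define X where "X = {x. \<exists>t. mem (tau t) x}"
  have mono: "prefix (tau t) (tau t')" if "t \<le> t'" for t t'
    using that by (induction rule: dec_induct) (auto intro: chain prefix_order.trans)
  have mem: "x \<in> X \<longleftrightarrow> mem (tau t) x" if "x < length (tau t)" for x t
  proof
    assume "x \<in> X"
    then obtain t' where t': "mem (tau t') x" by (auto simp: X_def)
    show "mem (tau t) x"
    proof (cases "t \<le> t'")
      case True then show ?thesis using mem_prefix[OF mono[OF True] that] t' by simp
    next
      case False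
      then have "prefix (tau t') (tau t)" by (simp add: mono)
      then show ?thesis using mem_prefix mem_length t' by blast
    qed
  qed (auto simp: X_def)
  have long: "\<exists>t\<ge>t0. m \<le> length (tau t)" for m t0
  proof -
    obtain t x where "m \<le> x" "mem (tau t) x" using unb by blast
    then have "m \<le> length (tau t)" using mem_length by fastforce
    also have "length (tau t) \<le> length (tau (max t t0))" by (simp add: mono prefix_length_le)
    finally show ?thesis using max.cobounded2 by blast
  qed
  have res: "prefix (res X m) (tau t)" if "m \<le> length (tau t)" for m t
    using that mem[of _ t] by (auto simp: prefix_mem_iff)
  show ?thesis
  proof (intro exI[of _ X] conjI allI)
    show "X \<subseteq> D" using D by (auto simp: X_def)
    show "infinite X" unfolding infinite_nat_iff_unbounded_le using unb by (simp add: X_def) blast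
    have ex: "\<exists>t. x < length (tau t)" for x using long[of 0 "Suc x"] by (auto simp: Suc_le_eq)
    \<comment> \<open>Strings are never retracted, so the first one longer than \<open>x\<close>
      decides membership.\<close>
    have "cf halting_set (\<lambda>x. mem (tau (LEAST t. x < length (tau t))) x)"
      by (intro cf_intros cf_compose[OF tau] ex)
    moreover have "mem (tau (LEAST t. x < length (tau t))) x \<longleftrightarrow> x \<in> X" for x
      using mem[OF LeastI_ex[OF ex]] by simp
    ultimately show "Delta02 X" by (simp add: Delta02_def turing_reducible_cf)
    show "\<not> C i \<le>\<^sub>T X" for i
    proof
      assume "C i \<le>\<^sub>T X"
      then obtain f where f: "\<And>n. evalo X f [n] (chi (C i) n)" unfolding turing_reducible_def by blast
      from req[where i = i and e = "encode f"] obtain t where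
        "(\<exists>n v. E (encode f) (tau t) n v \<and> v \<noteq> chi (C i) n) \<or>
          (\<exists>p. \<not> SP (tau t) (encode f) (L p) \<and> (\<forall>t'\<ge>t. extn (tau t) (L p) (tau t')))" ..
      then show False
      proof (elim disjE exE conjE)
        fix n v assume v: "E (encode f) (tau t) n v" "v \<noteq> chi (C i) n"
        have "prefix (tau t) (res X (length (tau t)))"
          using mem[of _ t] by (auto simp: prefix_mem_iff)
        then have "E (encode f) (res X (length (tau t))) n v" using v(1) E_mono by blast
        then have "evalo X f [n] v" using E_iff by blast
        then show False using evalo_det f v(2) by blast
      next
        fix p assume p: "\<not> SP (tau t) (encode f) (L p)" "\<forall>t'\<ge>t. extn (tau t) (L p) (tau t')"
        have "extn (tau t) (L p) (res X m)" if "length (tau t) \<le> m" for m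
        proof -
          obtain t' where t': "t' \<ge> t" "m \<le> length (tau t')" using long by blast
          have e: "extn (tau t) (L p) (tau t')" using p(2) t'(1) by blast
          have r: "prefix (res X m) (tau t')" by (rule res[OF t'(2)])
          have "prefix (tau t) (res X m)"
            using extn_prefix[OF e] r that by (metis length_res prefix_length_prefix)
          moreover have "x \<in> L p" if "x < m" "length (tau t) \<le> x" "x \<in> X" for x
            using e that t'(2) mem[of x t'] by (auto simp: extn_def)
          ultimately show ?thesis by (auto simp: extn_def)
        qed
        from cf_of_no_split[OF p(1) cf_L' this f] show False using avoids by blast
      qed
    qed
  qed
qed

lemma extn_add_true:
  assumes "infinite U"
  shows "\<exists>u. extn s U u \<and> (\<exists>x<length u. length s \<le> x \<and> mem u x)"
proof -
  obtain x where x: "x \<in> U" "length s \<le> x" using assms unfolding infinite_nat_iff_unbounded_le by blast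
  let ?u = "pad s x @ [True]"
  have "extn (pad s x) U ?u" using x by (auto simp: extn_def nth_append mem_def less_Suc_eq split: if_splits)
  then have "extn s U ?u" using extn_trans extn_pad by blast
  moreover have "mem ?u x" "x < length ?u" using x(2) by (auto simp: mem_def nth_append max_def)
  ultimately show ?thesis using x(2) by blast
qed

lemma not_SP_extn: "\<not> SP s e L' \<Longrightarrow> extn s U u \<Longrightarrow> U \<subseteq> L' \<Longrightarrow> \<not> SP u e L'"
  using SP_extn extn_mono by blast

text \<open>If every splitting question over \<open>L p\<close> is settled by a splitting inside \<open>D\<close> or by the absence
  of splittings beyond some point, then finite extensions alone build a subset of \<open>D\<close>.\<close>

lemma settled_reservoir:
  assumes D_cf: "cf halting_set (\<lambda>x. x \<in> D)" and inf: "infinite (L p \<inter> D)"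
    and settled: "\<And>s e. SP s e (L p \<inter> D) \<or> (\<exists>k. \<not> SP (pad s k) e (L p))"
  shows "\<exists>X. X \<subseteq> D \<and> infinite X \<and> Delta02 X \<and> (\<forall>i. \<not> C i \<le>\<^sub>T X)"
proof -
  \<comment> \<open>The number \<open>k\<close> codes the requirement \<open>(i, e)\<close>; the
    extra new element makes the limit infinite.\<close>
  define works where "works k s u \<longleftrightarrow> extn s (L p \<inter> D) u \<and> (\<exists>x<length u. length s \<le> x \<and> mem u x) \<and>
    (\<not> SP u (snd (prod_decode k)) (L p) \<or>
      (\<exists>n<length u. \<exists>v<length u. E (snd (prod_decode k)) u n v \<and> v \<noteq> chi (C (fst (prod_decode k))) n))" for k s u
  have ex: "\<exists>d. works k s (str_of d)" for k s
  proof -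
    let ?e = "snd (prod_decode k)" and ?C = "C (fst (prod_decode k))"
    have "\<exists>u. works k s u"
      using settled[of s ?e]
    proof (elim disjE exE)
      assume "SP s ?e (L p \<inter> D)"
      from SP_diagonalize[OF this] obtain u n v where u: "extn s (L p \<inter> D) u" "E ?e u n v" "v \<noteq> chi ?C n" .
      obtain w where w: "extn u (L p \<inter> D) w" "\<exists>x<length w. length u \<le> x \<and> mem w x"
        using extn_add_true[OF inf] by blast
      have E: "E ?e w n v" using u(2) w(1) E_mono extn_prefix by blast
      have "length s \<le> length u" using u(1) extn_prefix prefix_length_le by blast
      then have "works k s w" unfolding works_def
        using extn_trans[OF u(1) w(1)] w(2) E E_less[OF E] u(3) by (meson order_trans)
      then show ?thesis ..
    next
      fix j assume j: "\<not> SP (pad s j) ?e (L p)"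
      obtain w where w: "extn (pad s j) (L p \<inter> D) w" "\<exists>x<length w. length (pad s j) \<le> x \<and> mem w x"
        using extn_add_true[OF inf] by blast
      have "\<not> SP w ?e (L p)" using not_SP_extn[OF j w(1)] by blast
      then have "works k s w" unfolding works_def
        using extn_trans[OF extn_pad w(1)] w(2) by auto
      then show ?thesis ..
    qed
    then show ?thesis using str_of_surj by metis
  qed
  define tau where "tau = rec_nat [] (\<lambda>k s. str_of (LEAST d. works k s (str_of d)))"
  have step: "works k (tau k) (tau (Suc k))" for k
    using LeastI_ex[OF ex[of k "tau k"]] by (simp add: tau_def)
  have DL: "cf halting_set (\<lambda>x. f x \<in> L p \<inter> D)" if "cf halting_set f" for f :: "'z::ecode \<Rightarrow> nat"
    by (intro cf_Int cf_L cf_const that cf_compose[OF D_cf])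
  have "cf halting_set (\<lambda>k. rec_nat [] (\<lambda>k s. str_of (LEAST d. works k s (str_of d))) k)"
    by (intro cf_intros ex) (unfold works_def, intro cf_intros cf_SP cf_chi_C DL)
  then have cf: "cf halting_set tau" by (simp add: tau_def)
  have chain: "extn (tau k) (L p \<inter> D) (tau (Suc k))" for k using step unfolding works_def by blast
  have chain': "extn (tau k) (L p \<inter> D) (tau k')" if "k \<le> k'" for k k'
    using that by (induction rule: dec_induct) (auto intro: chain extn_trans)
  have len: "k \<le> length (tau k)" for k
  proof (induction k)
    case (Suc k)
    then show ?case using step[of k] unfolding works_def by auto
  qed simp
  show ?thesis
  proof (rule limit_set[OF cf])
    show "prefix (tau k) (tau (Suc k))" for k using chain extn_prefix by blast
    show "x \<in> D" if "mem (tau k) x" for k x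
      using chain'[of 0 k] that mem_length[OF that] by (auto simp: extn_def tau_def)
    show "\<exists>t x. k \<le> x \<and> mem (tau t) x" for k
      using step[of k] len[of k] unfolding works_def by (meson order_trans)
    fix i e
    let ?k = "prod_encode (i, e)"
    have "(\<exists>n v. E e (tau (Suc ?k)) n v \<and> v \<noteq> chi (C i) n) \<or> \<not> SP (tau (Suc ?k)) e (L p)"
      using step[of ?k] unfolding works_def by auto
    moreover have "extn (tau (Suc ?k)) (L p) (tau t')" if "t' \<ge> Suc ?k" for t'
      using extn_mono[OF chain'[OF that]] by blast
    ultimately show "\<exists>t. (\<exists>n v. E e (tau t) n v \<and> v \<noteq> chi (C i) n) \<or>
      (\<exists>p. \<not> SP (tau t) e (L p) \<and> (\<forall>t'\<ge>t. extn (tau t) (L p) (tau t')))" by blast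
  qed
qed

end

text \<open>A guess for the reservoir \<open>L p\<close> is a pair \<open>(s, e)\<close> such that splittings over \<open>s\<close> exist in \<open>L p\<close>
  arbitrarily far out, but not inside \<open>A\<close>. Wrong guesses are eventually refuted, so that a finite
  injury argument finds the correct one.\<close>

locale injury = reservoir +
  fixes A :: "nat set"
  assumes A_cf: "cf halting_set (\<lambda>x. x \<in> A)"
    and outside_A: "\<And>p. infinite (L p) \<Longrightarrow> infinite (L p - A)"
    and guess_ex: "\<And>p. infinite (L p) \<Longrightarrow> \<exists>s e. \<not> SP s e (L p \<inter> A) \<and> (\<forall>k. SP (pad s k) e (L p))"
begin

definition gs :: "nat \<times> nat \<Rightarrow> bool list" where
  "gs x = str_of (fst (prod_decode (snd x)))"

definition ge :: "nat \<times> nat \<Rightarrow> nat" where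
  "ge x = snd (prod_decode (snd x))"

text \<open>The first alternative is bounded by \<open>t\<close> since \<open>A\<close> is given
  only through 0'; the second is an unbounded question about \<open>L\<close>, which 0' can
  answer.\<close>

definition Rf :: "nat \<times> nat \<Rightarrow> nat \<Rightarrow> bool" where
  "Rf x t \<longleftrightarrow> Sp (gs x) (ge x) (L (fst x) \<inter> A) t \<or> \<not> SP (pad (gs x) t) (ge x) (L (fst x))"

text \<open>The oldest refuted entry keeps its reservoir and moves to its next guess; everything
  chosen on the strength of the old guess is dropped.\<close>

primrec trim :: "nat \<Rightarrow> (nat \<times> nat) list \<Rightarrow> (nat \<times> nat) list" where
  "trim t [] = []"
| "trim t (x # xs) = (if Rf x t then [(fst x, Suc (snd x))] else x # trim t xs)"

definition lst :: "(nat \<times> nat) list \<Rightarrow> nat \<times> nat" where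
  "lst st = nthd (0, 0) st (length st - 1)"

definition code :: "nat \<times> nat \<Rightarrow> nat \<Rightarrow> nat \<Rightarrow> nat" where
  "code x b r = ec (fst x, fst (prod_decode (snd x)), snd (prod_decode (snd x)), b, snd (prod_decode r))"

text \<open>The number \<open>b\<close> codes a candidate extension. It succeeds if the class
  attached to it has a member, to become the next reservoir, or if it already computes a wrong value
  for requirement \<open>r\<close>.\<close>

definition works :: "bool list \<Rightarrow> nat \<times> nat \<Rightarrow> nat \<Rightarrow> nat \<Rightarrow> bool" where
  "works s x b r \<longleftrightarrow> extn s (L (fst x) - A) (str_of b) \<and>
    (\<exists>y<length (str_of b). length s \<le> y \<and> mem (str_of b) y) \<and>
    (inQ (code x b r) \<or> (\<exists>n<length (str_of b). \<exists>v<length (str_of b).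
      E (snd (prod_decode r)) (str_of b) n v \<and> v \<noteq> chi (C (fst (prod_decode r))) n))"

text \<open>The stack holds one entry (reservoir index, guess) per requirement, the oldest entry first.\<close>

definition step :: "nat \<Rightarrow> bool list \<times> (nat \<times> nat) list \<Rightarrow> bool list \<times> (nat \<times> nat) list" where
  "step t W = (if trim t (snd W) \<noteq> snd W then (fst W, trim t (snd W))
    else if works (fst W) (lst (snd W)) (fst (prod_decode t)) (length (snd W) - 1)
    then (str_of (fst (prod_decode t)), snd W @
      [(if inQ (code (lst (snd W)) (fst (prod_decode t)) (length (snd W) - 1))
        then Suc (code (lst (snd W)) (fst (prod_decode t)) (length (snd W) - 1)) else fst (lst (snd W)), 0)])
    else W)"

primrec run :: "nat \<Rightarrow> bool list \<times> (nat \<times> nat) list" where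
  "run 0 = ([], [(0, 0)])"
| "run (Suc t) = step t (run t)"

definition tau :: "nat \<Rightarrow> bool list" where "tau t = fst (run t)"
definition stk :: "nat \<Rightarrow> (nat \<times> nat) list" where "stk t = snd (run t)"

lemma cf_LA:
  assumes "cf halting_set p" "cf halting_set f"
  shows "cf halting_set (\<lambda>x. f x \<in> L (p x) - A)" "cf halting_set (\<lambda>x. f x \<in> L (p x) \<inter> A)"
  by (intro cf_Int cf_Diff cf_L assms cf_compose[OF A_cf])+

lemma cf_gs: "cf halting_set x \<Longrightarrow> cf halting_set (\<lambda>y. gs (x y))"
  unfolding gs_def by (intro cf_intros)

lemma cf_ge: "cf halting_set x \<Longrightarrow> cf halting_set (\<lambda>y. ge (x y))"
  unfolding ge_def by (intro cf_intros)

lemma cf_Rf: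
  assumes "cf halting_set x" "cf halting_set t" shows "cf halting_set (\<lambda>y. Rf (x y) (t y))"
  unfolding Rf_def
  by (intro cf_intros cf_SP cf_LA cf_gs cf_ge assms cf_compose[OF assms(1)])

lemma cf_trim: "cf halting_set t \<Longrightarrow> cf halting_set l \<Longrightarrow> cf halting_set (\<lambda>y. trim (t y) (l y))"
proof (rule cf_comp2[where F = trim])
  have "cf halting_set (\<lambda>u. rec_list [] (\<lambda>x xs r. if Rf x (fst u) then [(fst x, Suc (snd x))] else x # r) (snd u))"
    by (intro cf_intros cf_Rf)
  moreover have "rec_list [] (\<lambda>x xs r. if Rf x t then [(fst x, Suc (snd x))] else x # r) l = trim t l" for t l
    by (induction l) auto
  ultimately show "cf halting_set (\<lambda>u. trim (fst u) (snd u))" by simp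
qed

lemma cf_lst: "cf halting_set l \<Longrightarrow> cf halting_set (\<lambda>y. lst (l y))"
  unfolding lst_def by (intro cf_intros)

lemma cf_code: "cf halting_set x \<Longrightarrow> cf halting_set b \<Longrightarrow> cf halting_set r \<Longrightarrow> cf halting_set (\<lambda>y. code (x y) (b y) (r y))"
  unfolding code_def by (intro cf_intros)

lemma cf_works:
  assumes "cf halting_set s" "cf halting_set x" "cf halting_set b" "cf halting_set r"
  shows "cf halting_set (\<lambda>y. works (s y) (x y) (b y) (r y))"
  unfolding works_def
  by (intro cf_intros cf_inQ cf_code cf_LA cf_chi_C assms cf_compose[OF assms(1)] cf_compose[OF assms(2)]
      cf_compose[OF assms(3)] cf_compose[OF assms(4)])

lemma cf_step:
  assumes "cf halting_set t" "cf halting_set W" shows "cf halting_set (\<lambda>y. step (t y) (W y))"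
  unfolding step_def by (intro cf_intros cf_trim cf_works cf_lst cf_inQ cf_code assms)

lemma cf_tau: "cf halting_set tau"
proof -
  have "cf halting_set (\<lambda>t. fst (rec_nat ([], [(0, 0)]) (\<lambda>t W. step t W) t))"
    by (intro cf_intros cf_step)
  moreover have "rec_nat ([], [(0, 0)]) (\<lambda>t W. step t W) t = run t" for t
    by (induction t) auto
  ultimately show ?thesis by (simp add: tau_def[abs_def])
qed

text \<open>A splitting inside \<open>A\<close> persists, and splittings beyond a later bound would
  also lie beyond an earlier one.\<close>

lemma Rf_mono:
  assumes "Rf x t" "t \<le> t'" shows "Rf x t'"
proof -
  have "SP (pad (gs x) t) (ge x) (L (fst x))" if "SP (pad (gs x) t') (ge x) (L (fst x))"
  proof (rule SP_extn[OF that])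
    show "extn (pad (gs x) t) (L (fst x)) (pad (gs x) t')"
      using assms(2) by (auto simp: extn_def prefix_mem_iff max_def dest: mem_length)
  qed
  moreover have "Sp (gs x) (ge x) (L (fst x) \<inter> A) t'" if "Sp (gs x) (ge x) (L (fst x) \<inter> A) t"
    by (rule Sp_mono[OF that assms(2)])
  ultimately show ?thesis using assms(1) unfolding Rf_def by blast
qed

lemma true_guess:
  assumes "infinite (L p)" shows "\<exists>g. \<forall>t. \<not> Rf (p, g) t"
proof -
  obtain s e where s: "\<not> SP s e (L p \<inter> A)" "\<And>k. SP (pad s k) e (L p)" using guess_ex[OF assms] by blast
  obtain a where "str_of a = s" using str_of_surj by blast
  then have "\<not> Rf (p, prod_encode (a, e)) t" for t
    using s by (auto simp: Rf_def gs_def ge_def SP_def)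
  then show ?thesis by blast
qed

lemma unrefuted:
  assumes "\<And>t. \<not> Rf x t"
  shows "\<not> SP (gs x) (ge x) (L (fst x) \<inter> A)" "SP (pad (gs x) k) (ge x) (L (fst x))"
  using assms unfolding Rf_def SP_def by blast+

lemma trim_unrefuted: "(\<And>x. x \<in> set l \<Longrightarrow> \<not> Rf x t) \<Longrightarrow> trim t l = l"
  by (induction l) auto

lemma trim_refuted:
  "x \<in> set l \<Longrightarrow> Rf x t \<Longrightarrow> \<exists>j<length l. Rf (l ! j) t \<and> (\<forall>i<j. \<not> Rf (l ! i) t) \<and>
    trim t l = take j l @ [(fst (l ! j), Suc (snd (l ! j)))]"
proof (induction l)
  case (Cons y l)
  show ?case
  proof (cases "Rf y t")
    case True then show ?thesis by (intro exI[of _ 0]) auto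
  next
    case False
    with Cons obtain j where "j < length l" "Rf (l ! j) t" "\<forall>i<j. \<not> Rf (l ! i) t"
      "trim t l = take j l @ [(fst (l ! j), Suc (snd (l ! j)))]" by auto
    with False show ?thesis by (intro exI[of _ "Suc j"]) (auto simp: less_Suc_eq_0_disj)
  qed
qed simp

section \<open>Behaviour of the stack in the injury construction\<close>

lemma run_cases:
  obtains (trim) j where "j < length (stk t)" "Rf (stk t ! j) t" "\<And>i. i < j \<Longrightarrow> \<not> Rf (stk t ! i) t"
      "tau (Suc t) = tau t" "stk (Suc t) = take j (stk t) @ [(fst (stk t ! j), Suc (snd (stk t ! j)))]"
  | (push) p where "\<And>x. x \<in> set (stk t) \<Longrightarrow> \<not> Rf x t"
      "works (tau t) (lst (stk t)) (fst (prod_decode t)) (length (stk t) - 1)"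
      "tau (Suc t) = str_of (fst (prod_decode t))" "stk (Suc t) = stk t @ [(p, 0)]"
      "p = (if inQ (code (lst (stk t)) (fst (prod_decode t)) (length (stk t) - 1))
        then Suc (code (lst (stk t)) (fst (prod_decode t)) (length (stk t) - 1)) else fst (lst (stk t)))"
  | (stay) "\<And>x. x \<in> set (stk t) \<Longrightarrow> \<not> Rf x t"
      "\<not> works (tau t) (lst (stk t)) (fst (prod_decode t)) (length (stk t) - 1)"
      "tau (Suc t) = tau t" "stk (Suc t) = stk t"
proof (cases "\<exists>x\<in>set (stk t). Rf x t")
  case True
  then obtain j where j: "j < length (stk t)" "Rf (stk t ! j) t" "\<forall>i<j. \<not> Rf (stk t ! i) t"
    "trim t (stk t) = take j (stk t) @ [(fst (stk t ! j), Suc (snd (stk t ! j)))]"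
    using trim_refuted by blast
  have "trim t (stk t) ! j \<noteq> stk t ! j" using j(1) unfolding j(4) by (simp add: nth_append prod_eq_iff)
  then have "trim t (stk t) \<noteq> stk t" by metis
  then have "run (Suc t) = (tau t, trim t (stk t))" by (simp add: step_def tau_def stk_def)
  then show ?thesis using j that(1) by (simp add: tau_def stk_def)
next
  case False
  then have n: "trim t (stk t) = stk t" using trim_unrefuted by blast
  show ?thesis
  proof (cases "works (tau t) (lst (stk t)) (fst (prod_decode t)) (length (stk t) - 1)")
    case True
    with n False show ?thesis by (intro that(2)) (auto simp: tau_def stk_def step_def)
  next
    case w: False
    with n False show ?thesis by (intro that(3)) (auto simp: tau_def stk_def step_def)
  qed
qed

lemma code_Q:
  assumes "inQ (code x b r)"
  shows "Q (fst x, fst (prod_decode (snd x)), snd (prod_decode (snd x)), b, snd (prod_decode r))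
    (L (fst x)) (L (Suc (code x b r)))"
  using assms by (simp add: inQ_def code_def)

lemma code_subset: "inQ (code x b r) \<Longrightarrow> L (Suc (code x b r)) \<subseteq> L (fst x)"
  using code_Q by (simp add: Q_def)

lemma stk_nonempty: "stk t \<noteq> []"
proof (induction t)
  case 0 show ?case by (simp add: stk_def)
next
  case (Suc t) show ?case by (cases t rule: run_cases) (use Suc in auto)
qed

lemma lst_last: "st \<noteq> [] \<Longrightarrow> lst st = st ! (length st - 1)"
  by (simp add: lst_def nthd_def)

text \<open>A push selects a subset of the last reservoir or repeats it, and trimming changes only a
  guess.\<close>

lemma stk_nested: "i \<le> j \<Longrightarrow> j < length (stk t) \<Longrightarrow> L (fst (stk t ! j)) \<subseteq> L (fst (stk t ! i))"
proof (induction t arbitrary: i j)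
  case 0 then show ?case by (simp add: stk_def)
next
  case (Suc t)
  show ?case
  proof (cases t rule: run_cases)
    case (trim k)
    have "fst (stk (Suc t) ! n) = fst (stk t ! n)" if "n \<le> k" for n
      using that trim(1) unfolding trim(5) by (auto simp: nth_append le_less)
    with Suc trim show ?thesis by auto
  next
    case (push p)
    have p: "L p \<subseteq> L (fst (lst (stk t)))" using push(5) code_subset by auto
    show ?thesis
    proof (cases "j = length (stk t)")
      case True
      then show ?thesis
      proof (cases "i = j")
        case False
        with True Suc.prems have "i < length (stk t)" by simp
        then have "L (fst (lst (stk t))) \<subseteq> L (fst (stk t ! i))"
          using Suc.IH[of i "length (stk t) - 1"] lst_last[OF stk_nonempty, of t] by simp
        with p True \<open>i < length (stk t)\<close> show ?thesis unfolding push(4) by (auto simp: nth_append)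
      qed simp
    next
      case False
      with Suc.prems show ?thesis using Suc.IH[of i j] unfolding push(4) by (auto simp: nth_append)
    qed
  next
    case stay with Suc show ?thesis by simp
  qed
qed

text \<open>Injury never retracts the string. A push extends it inside the last reservoir, which
  lies in all earlier ones.\<close>

lemma tau_step: "j < length (stk t) \<Longrightarrow> extn (tau t) (L (fst (stk t ! j)) - A) (tau (Suc t))"
proof (cases t rule: run_cases)
  case (push p)
  assume "j < length (stk t)"
  then have "L (fst (lst (stk t))) \<subseteq> L (fst (stk t ! j))"
    using stk_nested[of j "length (stk t) - 1" t] lst_last[OF stk_nonempty, of t] by simp
  moreover have "extn (tau t) (L (fst (lst (stk t))) - A) (tau (Suc t))"
    using push(2) unfolding push(3) works_def by blast
  ultimately show ?thesis using extn_mono by blast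
qed auto

lemma tau_extn:
  assumes "t \<le> t'" "\<And>u. t \<le> u \<Longrightarrow> j < length (stk u) \<and> fst (stk u ! j) = p"
  shows "extn (tau t) (L p - A) (tau t')"
  using assms(1)
proof (induction rule: dec_induct)
  case (step u)
  then show ?case using tau_step[of j u] assms(2)[of u] extn_trans by metis
qed simp

text \<open>Entry \<open>j\<close> is on top and all guesses up to it are final. The length bound
  ensures that the element added next is at least \<open>j\<close>.\<close>

definition stable :: "nat \<Rightarrow> nat \<Rightarrow> bool" where
  "stable j t \<longleftrightarrow> length (stk t) = Suc j \<and> j \<le> length (tau t) \<and> infinite (L (fst (stk t ! j))) \<and>
    (\<forall>i\<le>j. \<forall>u. \<not> Rf (stk t ! i) u)"

lemma unrefuted_prefix:
  assumes "j \<le> length (stk t)" "\<And>i u. i < j \<Longrightarrow> \<not> Rf (stk t ! i) u" "t \<le> u"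
  shows "j \<le> length (stk u) \<and> take j (stk u) = take j (stk t)"
  using assms(3)
proof (induction rule: dec_induct)
  case (step u)
  have eq: "stk u ! i = stk t ! i" if "i < j" for i
    using step.IH that by (metis nth_take)
  show ?case
  proof (cases u rule: run_cases)
    case (trim k)
    have "\<not> k < j" using trim(2) eq assms(2) by metis
    with trim step.IH show ?thesis by simp
  next
    case push with step.IH show ?thesis by simp
  next
    case stay with step.IH show ?thesis by simp
  qed
qed (use assms(1) in simp)

lemma entry_step:
  assumes "j < length (stk u)" "\<And>i. i < j \<Longrightarrow> \<not> Rf (stk u ! i) u"
  shows "j < length (stk (Suc u))"
    "stk (Suc u) ! j = (if Rf (stk u ! j) u then (fst (stk u ! j), Suc (snd (stk u ! j))) else stk u ! j)"
    "Rf (stk u ! j) u \<Longrightarrow> length (stk (Suc u)) = Suc j"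
proof -
  have "j < length (stk (Suc u)) \<and>
    stk (Suc u) ! j = (if Rf (stk u ! j) u then (fst (stk u ! j), Suc (snd (stk u ! j))) else stk u ! j) \<and>
    (Rf (stk u ! j) u \<longrightarrow> length (stk (Suc u)) = Suc j)"
  proof (cases u rule: run_cases)
    case (trim k)
    then have "j \<le> k" using assms(2) by (metis linorder_not_less)
    show ?thesis
    proof (cases "j = k")
      case True with trim show ?thesis by (simp add: nth_append)
    next
      case False
      then have "\<not> Rf (stk u ! j) u" "j < k" using trim(3) \<open>j \<le> k\<close> by auto
      with trim show ?thesis by (simp add: nth_append)
    qed
  next
    case push
    then have "\<not> Rf (stk u ! j) u" using assms(1) nth_mem by blast
    with push(4) assms(1) show ?thesis by (simp add: nth_append)
  next
    case stay
    then have "\<not> Rf (stk u ! j) u" using assms(1) nth_mem by blast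
    with stay(4) assms(1) show ?thesis by simp
  qed
  then show "j < length (stk (Suc u))"
    "stk (Suc u) ! j = (if Rf (stk u ! j) u then (fst (stk u ! j), Suc (snd (stk u ! j))) else stk u ! j)"
    "Rf (stk u ! j) u \<Longrightarrow> length (stk (Suc u)) = Suc j" by auto
qed

text \<open>The guess of entry \<open>j\<close> grows only when refuted, so it never passes the
  correct guess \<open>g\<close>. It reaches a maximum, which is never refuted since refutations
  persist and would increase it.\<close>

lemma stabilize:
  assumes len: "length (stk t) = Suc j" and ent: "stk t ! j = (p, 0)" and inf: "infinite (L p)"
    and low: "\<And>i u. i < j \<Longrightarrow> \<not> Rf (stk t ! i) u" and long: "j \<le> length (tau t)"
  shows "\<exists>u\<ge>t. stable j u \<and> fst (stk u ! j) = p \<and>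
    (\<forall>u'\<ge>t. j < length (stk u') \<and> fst (stk u' ! j) = p)"
proof -
  obtain g where g: "\<And>u. \<not> Rf (p, g) u" using true_guess[OF inf] by blast
  have pre: "\<And>u. t \<le> u \<Longrightarrow> j \<le> length (stk u) \<and> take j (stk u) = take j (stk t)"
    by (rule unrefuted_prefix) (use len low in auto)
  have below: "\<not> Rf (stk u ! i) w" if "t \<le> u" "i < j" for u i w
    using pre[OF that(1)] that(2) low by (metis nth_take)
  have inv: "j < length (stk u) \<and> fst (stk u ! j) = p \<and> snd (stk u ! j) \<le> g" if "t \<le> u" for u
    using that
  proof (induction rule: dec_induct)
    case (step u)
    have b: "\<And>i. i < j \<Longrightarrow> \<not> Rf (stk u ! i) u" using below step.hyps by blast
    have "snd (stk u ! j) < g" if "Rf (stk u ! j) u"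
      using that g step.IH by (metis le_neq_implies_less prod.collapse)
    then show ?case using entry_step[of j u, OF _ b] step.IH by auto
  qed (use len ent in simp)
  define V where "V = {snd (stk u ! j) | u. t \<le> u}"
  have fin: "finite V" "V \<noteq> {}"
    by (rule finite_subset[of _ "{..g}"]) (use inv in \<open>auto simp: V_def\<close>)
  define M where "M = Max V"
  have "M \<in> V" unfolding M_def by (rule Max_in[OF fin])
  then have exM: "\<exists>u. t \<le> u \<and> snd (stk u ! j) = M" by (auto simp: V_def)
  have leM: "snd (stk u ! j) \<le> M" if "t \<le> u" for u
    unfolding M_def by (rule Max_ge[OF fin(1)]) (use that in \<open>auto simp: V_def\<close>)
  define u where "u = (LEAST u. t \<le> u \<and> snd (stk u ! j) = M)"
  have u: "t \<le> u" "snd (stk u ! j) = M" using LeastI_ex[OF exM] unfolding u_def by auto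
  have before: "snd (stk w ! j) \<noteq> M" if "w < u" "t \<le> w" for w
    using not_less_Least[OF that(1)[unfolded u_def]] that(2) by blast
  have const: "snd (stk w ! j) = M" if "u \<le> w" for w
    using that
  proof (induction rule: dec_induct)
    case (step w)
    have tw: "t \<le> w" using step.hyps u(1) by simp
    have b: "\<And>i. i < j \<Longrightarrow> \<not> Rf (stk w ! i) w" using below tw by blast
    have "\<not> Rf (stk w ! j) w"
      using entry_step[of j w, OF _ b] inv[OF tw] leM[of "Suc w"] tw step.IH by fastforce
    then show ?case using entry_step(2)[of j w, OF _ b] inv[OF tw] step.IH by simp
  qed (rule u(2))
  have nRf: "\<not> Rf (p, M) w" for w
  proof
    assume "Rf (p, M) w"
    let ?w = "max u w"
    have "t \<le> ?w" using u(1) by simp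
    have e: "stk ?w ! j = (p, M)"
      using const[of ?w] inv[OF \<open>t \<le> ?w\<close>] by (simp add: prod_eq_iff)
    have r: "Rf (stk ?w ! j) ?w" unfolding e by (rule Rf_mono[OF \<open>Rf (p, M) w\<close>]) simp
    have b: "\<And>i. i < j \<Longrightarrow> \<not> Rf (stk ?w ! i) ?w" using below[OF \<open>t \<le> ?w\<close>] by blast
    have "snd (stk (Suc ?w) ! j) = Suc M"
      using entry_step(2)[of j ?w, OF _ b] inv[OF \<open>t \<le> ?w\<close>] r e by simp
    moreover have "snd (stk (Suc ?w) ! j) = M" by (rule const) simp
    ultimately show False by simp
  qed
  \<comment> \<open>The maximal guess is either the initial one or appears right after a trim at
    \<open>j\<close>, which leaves that entry on top.\<close>
  have lenu: "length (stk u) = Suc j"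
  proof (cases "u = t")
    case False
    then obtain w where w: "u = Suc w" "t \<le> w" using u(1) by (cases u) auto
    have b: "\<And>i. i < j \<Longrightarrow> \<not> Rf (stk w ! i) w" using below[OF w(2)] by blast
    have "Rf (stk w ! j) w"
    proof (rule ccontr)
      assume "\<not> ?thesis"
      then have "stk u ! j = stk w ! j" using entry_step(2)[of j w, OF _ b] inv[OF w(2)] w(1) by simp
      then show False using before[of w] w u(2) by simp
    qed
    then show ?thesis using entry_step(3)[of j w, OF _ b] inv[OF w(2)] w(1) by blast
  qed (simp add: len)
  have "extn (tau t) (L p - A) (tau u)" by (rule tau_extn[OF u(1)]) (use inv in blast)
  then have "j \<le> length (tau u)" using long extn_prefix prefix_length_le order_trans by blast
  moreover have e: "stk u ! j = (p, M)" using u(2) inv[OF u(1)] by (simp add: prod_eq_iff)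
  ultimately have "stable j u"
    unfolding stable_def using lenu inf nRf below[OF u(1)] by (metis fst_conv le_neq_implies_less)
  then show ?thesis using u(1) inv e by (metis fst_conv)
qed

text \<open>Any extension \<open>w\<close> by a new element is tried first. If no half can be chosen
  for it, a splitting over \<open>w\<close> in the complement of \<open>A\<close> supplies a wrong
  value.\<close>

lemma candidate_ex:
  assumes inf: "infinite (L (fst x))" and x: "\<And>u. \<not> Rf x u"
  shows "\<exists>b. works s x b r"
proof -
  let ?e = "snd (prod_decode r)" and ?C = "C (fst (prod_decode r))"
  obtain w where w: "extn s (L (fst x) - A) w" "\<exists>y<length w. length s \<le> y \<and> mem w y"
    using extn_add_true[OF outside_A[OF inf]] by blast
  obtain b where b: "str_of b = w" using str_of_surj by blast
  show ?thesis
  proof (cases "inQ (code x b r)")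
    case True
    then have "works s x b r" using w b by (simp add: works_def)
    then show ?thesis ..
  next
    case False
    let ?c = "(fst x, fst (prod_decode (snd x)), snd (prod_decode (snd x)), b, ?e)"
    \<comment> \<open>\<open>L_Suc\<close> would turn any member of the class into
      \<open>inQ\<close>. The other half \<open>L (fst x) \<inter> A\<close> is harmless by the
      guess, so the failure must come from a splitting in \<open>L (fst x) - A\<close>.\<close>
    have "\<not> Q ?c (L (fst x)) (L (fst x) - A)"
      using False L_Suc[of "code x b r"] by (auto simp: inQ_def code_def)
    moreover have "L (fst x) - (L (fst x) - A) = L (fst x) \<inter> A" by blast
    ultimately have "SP w ?e (L (fst x) - A)"
      using unrefuted(1)[OF x] b by (auto simp: Q_def gs_def ge_def)
    from SP_diagonalize[OF this] obtain u n v where u: "extn w (L (fst x) - A) u" "E ?e u n v" "v \<noteq> chi ?C n" .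
    obtain b' where b': "str_of b' = u" using str_of_surj by blast
    have pre: "prefix w u" using u(1) extn_prefix by blast
    have "\<exists>y<length u. length s \<le> y \<and> mem u y"
      using w(2) mem_prefix[OF pre] prefix_length_le[OF pre] by (meson order_less_le_trans)
    then have "works s x b' r"
      unfolding works_def b' using extn_trans[OF w(1) u(1)] u E_less[OF u(2)] by blast
    then show ?thesis ..
  qed
qed

text \<open>A finite half would leave the splittings beyond its bound, promised by the guess, inside
  its complement.\<close>

lemma inQ_infinite:
  assumes "inQ (code x b r)" and x: "\<And>u. \<not> Rf x u"
  shows "infinite (L (Suc (code x b r)))"
proof
  assume "finite (L (Suc (code x b r)))"
  then obtain k where k: "\<forall>y\<in>L (Suc (code x b r)). y < k" unfolding finite_nat_set_iff_bounded ..
  have "SP (pad (gs x) k) (ge x) (L (fst x))" by (rule unrefuted(2)[OF x])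
  then have "SP (pad (gs x) k) (ge x) (L (fst x) - L (Suc (code x b r)))"
    by (rule SP_mono) (use k in \<open>auto simp: not_less[symmetric]\<close>)
  then have "SP (gs x) (ge x) (L (fst x) - L (Suc (code x b r)))"
    by (rule SP_extn[OF _ extn_pad])
  then show False using code_Q[OF assms(1)] by (simp add: Q_def gs_def ge_def)
qed

text \<open>The first push over a final entry \<open>j\<close> settles requirement \<open>j\<close>
  for good: later strings stay inside the reservoir pushed, although its guess may still
  change.\<close>

lemma stable_Suc:
  assumes st: "stable j t"
  shows "\<exists>u\<ge>t. \<exists>w. stable (Suc j) w \<and> (\<exists>x\<ge>j. mem (tau u) x) \<and>
    ((\<exists>n v. E (snd (prod_decode j)) (tau u) n v \<and> v \<noteq> chi (C (fst (prod_decode j))) n) \<or>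
      (\<exists>p. \<not> SP (tau u) (snd (prod_decode j)) (L p) \<and> (\<forall>u'\<ge>u. extn (tau u) (L p) (tau u'))))"
proof -
  let ?x = "stk t ! j"
  have len: "length (stk t) = Suc j" and long: "j \<le> length (tau t)" and inf: "infinite (L (fst ?x))"
    and nRf: "\<And>i u. i \<le> j \<Longrightarrow> \<not> Rf (stk t ! i) u" using st by (auto simp: stable_def)
  have pre: "Suc j \<le> length (stk u) \<and> take (Suc j) (stk u) = stk t" if "t \<le> u" for u
    using unrefuted_prefix[of "Suc j" t u] that len nRf by (simp add: less_Suc_eq_le)
  have top: "j < length (stk u) \<and> fst (stk u ! j) = fst ?x" if "t \<le> u" for u
  proof -
    have "stk u ! j = take (Suc j) (stk u) ! j" by simp
    then show ?thesis using pre[OF that] by simp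
  qed
  have "\<exists>u\<ge>t. length (stk u) \<noteq> Suc j"
  proof (rule ccontr)
    assume "\<not> ?thesis"
    then have stk: "stk u = stk t" if "t \<le> u" for u using pre[OF that] that by fastforce
    have tau: "tau u = tau t" if "t \<le> u" for u
      using that
    proof (induction rule: dec_induct)
      case (step u)
      have "stk (Suc u) = stk u" using stk[of "Suc u"] stk[of u] step.hyps by simp
      then have "tau (Suc u) = tau u" by (cases u rule: run_cases) simp_all
      then show ?case using step.IH by simp
    qed simp
    obtain b where b: "works (tau t) ?x b j" using candidate_ex[OF inf nRf[OF order_refl]] by blast
    \<comment> \<open>A stage not before \<open>t\<close> at which the candidate tried is exactly
      \<open>b\<close>.\<close>
    let ?u = "prod_encode (b, t)"
    have u: "t \<le> ?u" by (rule le_prod_encode_2)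
    have l: "lst (stk ?u) = ?x" using lst_last[OF stk_nonempty, of ?u] stk[OF u] len by simp
    have same: "stk (Suc ?u) = stk ?u" using stk[of ?u] stk[of "Suc ?u"] u by simp
    show False
    proof (cases ?u rule: run_cases)
      case (trim k)
      then show ?thesis using nRf[of k] stk[OF u] len by simp
    next
      case push then show ?thesis using same by simp
    next
      case stay
      have "works (tau ?u) (lst (stk ?u)) (fst (prod_decode ?u)) (length (stk ?u) - 1)"
        unfolding l tau[OF u] using b stk[OF u] len by simp
      then show ?thesis using stay(2) by contradiction
    qed
  qed
  \<comment> \<open>Entries up to \<open>j\<close> are never refuted, so the first change of length
    can only be a push.\<close>
  define u where "u = (LEAST u. t \<le> u \<and> length (stk u) \<noteq> Suc j)"
  have u: "t \<le> u" "length (stk u) \<noteq> Suc j"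
    using LeastI_ex[OF \<open>\<exists>u\<ge>t. length (stk u) \<noteq> Suc j\<close>] unfolding u_def by auto
  have "u \<noteq> t" using u(2) len by blast
  then obtain w where w: "u = Suc w" "t \<le> w" using u(1) by (cases u) auto
  have "length (stk w) = Suc j"
    using not_less_Least[of w "\<lambda>u. t \<le> u \<and> length (stk u) \<noteq> Suc j"] w unfolding u_def by fastforce
  then have stkw: "stk w = stk t" using pre[OF w(2)] by simp
  have lw: "lst (stk w) = ?x" using lst_last[OF stk_nonempty, of w] stkw len by simp
  define b where "b = fst (prod_decode w)"
  obtain p where p: "works (tau w) ?x b j" "tau u = str_of b" "stk u = stk t @ [(p, 0)]"
    "p = (if inQ (code ?x b j) then Suc (code ?x b j) else fst ?x)"
  proof (cases w rule: run_cases)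
    case (trim k) then show ?thesis using nRf[of k] stkw len by simp
  next
    case (push p) then show ?thesis using that[of p] stkw lw len w(1) by (simp add: b_def)
  next
    case stay then show ?thesis using u(2) w(1) stkw len by simp
  qed
  have tw: "j \<le> length (tau w)"
  proof -
    have "extn (tau t) (L (fst ?x) - A) (tau w)"
      by (rule tau_extn[OF w(2) top])
    then have "length (tau t) \<le> length (tau w)" by (intro prefix_length_le extn_prefix)
    with long show ?thesis by simp
  qed
  obtain y where y: "length (tau w) \<le> y" "mem (tau u) y" using p(1) unfolding works_def p(2) by blast
  have infp: "infinite (L p)" using p(4) inf inQ_infinite[OF _ nRf[OF order_refl]] by simp
  have "Suc j \<le> length (tau u)" using tw y mem_length[OF y(2)] by simp
  then obtain v where v: "u \<le> v" "stable (Suc j) v"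
      "\<forall>u'\<ge>u. Suc j < length (stk u') \<and> fst (stk u' ! Suc j) = p"
    using stabilize[of u "Suc j" p] p(3) len infp nRf by (auto simp: nth_append less_Suc_eq_le)
  have ext: "extn (tau u) (L p) (tau u')" if "u \<le> u'" for u'
    by (rule extn_mono[OF tau_extn[OF that, of "Suc j" p]]) (use v(3) in auto)
  have "(\<exists>n v. E (snd (prod_decode j)) (tau u) n v \<and> v \<noteq> chi (C (fst (prod_decode j))) n) \<or>
      \<not> SP (tau u) (snd (prod_decode j)) (L p)"
  proof (cases "inQ (code ?x b j)")
    case True
    then show ?thesis using code_Q[OF True] p(2,4) by (simp add: Q_def)
  next
    case False
    then show ?thesis using p(1) unfolding works_def p(2) by blast
  qed
  moreover have "\<exists>x\<ge>j. mem (tau u) x" using y tw order_trans by blast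
  ultimately show ?thesis using u(1) v(2) ext by blast
qed

lemma stable_ex: "\<exists>t. stable j t"
proof (induction j)
  case 0
  have "\<exists>u\<ge>0. stable 0 u \<and> fst (stk u ! 0) = 0 \<and> (\<forall>u'\<ge>0. 0 < length (stk u') \<and> fst (stk u' ! 0) = 0)"
    by (rule stabilize) (simp_all add: stk_def L_0)
  then show ?case by blast
next
  case (Suc j) then show ?case using stable_Suc by blast
qed

theorem injury_set: "\<exists>X. X \<subseteq> - A \<and> infinite X \<and> Delta02 X \<and> (\<forall>i. \<not> C i \<le>\<^sub>T X)"
proof (rule limit_set[OF cf_tau])
  \<comment> \<open>The bottom entry always exists, so every new element, at any stage, lies outside
    \<open>A\<close>.\<close>
  have chain: "extn (tau t) (L (fst (stk t ! 0)) - A) (tau (Suc t))" for t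
    using tau_step stk_nonempty by blast
  show "prefix (tau t) (tau (Suc t))" for t using chain extn_prefix by blast
  show "x \<in> - A" if "mem (tau t) x" for t x
    using that
  proof (induction t)
    case 0 then show ?case by (simp add: tau_def mem_def)
  next
    case (Suc t)
    then show ?case using chain[of t] mem_prefix[OF extn_prefix[OF chain[of t]]] mem_length[OF Suc.prems]
      unfolding extn_def by (metis ComplI DiffD2 linorder_not_less)
  qed
  show "\<exists>t x. k \<le> x \<and> mem (tau t) x" for k using stable_ex[of k] stable_Suc by blast
  show "\<exists>t. (\<exists>n v. E e (tau t) n v \<and> v \<noteq> chi (C i) n) \<or>
      (\<exists>p. \<not> SP (tau t) e (L p) \<and> (\<forall>t'\<ge>t. extn (tau t) (L p) (tau t')))" for i e
  proof -
    obtain t where "stable (prod_encode (i, e)) t" using stable_ex by blast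
    from stable_Suc[OF this] show ?thesis unfolding prod_encode_inverse fst_conv snd_conv by blast
  qed
qed

end

theorem theorem4p5:
  fixes A :: "nat set" and C :: "nat \<Rightarrow> nat set"
  assumes "Delta02 A"
    and "uniformly_Delta02 C"
    and "\<forall>i. \<not> computable_set (C i)"
  shows "\<exists>X. (X \<subseteq> A \<or> X \<subseteq> - A) \<and> infinite X \<and> Delta02 X \<and> (\<forall>i. \<not> C i \<le>\<^sub>T X)"
proof -
  have A_cf: "cf halting_set (\<lambda>x. x \<in> A)"
    using assms(1) by (simp add: Delta02_def turing_reducible_cf)
  have C_cf: "cf halting_set (\<lambda>t. snd t \<in> C (fst t))"
  proof -
    from assms(2) obtain f where f: "\<And>i n. evalo halting_set f [i, n] (chi (C i) n)"
      unfolding uniformly_Delta02_def by blast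
    have "evalo halting_set (Comp f [fst_prog, snd_prog]) [prod_encode (i, n)] (chi (C i) n)" for i n
      by (rule evalo_Comp2[OF evalo_fst evalo_snd f])
    then show ?thesis unfolding cf_def
      by (intro exI[of _ "Comp f [fst_prog, snd_prog]"]) (simp add: ec_prod_def ec_nat_def ec_bool_def chi_def)
  qed
  have nc: "\<not> cf {} (\<lambda>n. n \<in> C i)" for i
    using assms(3) by (simp add: computable_set_def turing_reducible_cf)
  interpret basis tree C
    by standard (use cf_tree tree_prefix tree_infinite C_cf nc in auto)
  obtain G where G: "\<And>m. tree (res G m)"
    and low: "cf halting_set (\<lambda>c. \<exists>m. E (fst c) (res G m) (fst (snd c)) (snd (snd c)))"
    and avoids: "\<And>i. \<not> cf G (\<lambda>n. n \<in> C i)" using low_cone_avoiding by blast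
  define L where "L p = {x. prod_encode (p, x) \<in> G}" for p
  have L_cf: "cf G (\<lambda>t. snd t \<in> L (fst t))" unfolding L_def by (intro cf_intros)
  interpret reservoir C G L
    by standard (use C_cf low avoids L_cf tree_path[OF G] in \<open>auto simp: L_def\<close>)
  show ?thesis
  \<comment> \<open>This disposes of reservoirs almost contained in one side; both constructions
    need each infinite reservoir to meet their side infinitely often in order to keep adding
    elements.\<close>
  proof (cases "\<exists>p. infinite (L p) \<and> (finite (L p - A) \<or> finite (L p \<inter> A))")
    case True
    then show ?thesis
    proof (elim exE conjE disjE)
      fix p assume "infinite (L p)" "finite (L p - A)"
      from cofinite_reservoir[OF this] show ?thesis by blast
    next
      fix p assume "infinite (L p)" "finite (L p \<inter> A)"
      moreover have "L p - - A = L p \<inter> A" by blast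
      ultimately show ?thesis using cofinite_reservoir[of p "- A"] by auto
    qed
  next
    case False
    show ?thesis
    proof (cases "\<exists>p. infinite (L p) \<and> (\<forall>s e. SP s e (L p \<inter> A) \<or> (\<exists>k. \<not> SP (pad s k) e (L p)))")
      case True
      then obtain p where p: "infinite (L p)" "\<And>s e. SP s e (L p \<inter> A) \<or> (\<exists>k. \<not> SP (pad s k) e (L p))"
        by auto
      have "infinite (L p \<inter> A)" using p(1) False by blast
      from settled_reservoir[OF A_cf this p(2)] show ?thesis by blast
    next
      case no: False
      interpret injury C G L A
      proof
        show "infinite (L p - A)" if "infinite (L p)" for p using False that by blast
        show "\<exists>s e. \<not> SP s e (L p \<inter> A) \<and> (\<forall>k. SP (pad s k) e (L p))" if "infinite (L p)" for p
          using no that by blast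
      qed (rule A_cf)
      show ?thesis using injury_set by blast
    qed
  qed
qed

end
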